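(* Let $T$ be a tree of order $n$ and let $D = D(T)$. Then the Seidel energy of $T$ satisfies $$\mathcal{E}(S(T)) \geq 2n - 6 + \sqrt{2(n-D)}.$$
   Context: All graphs are simple and finite. For a graph $G$ with vertex set $\{v_1,\dots,v_n\}$, the Seidel matrix $S(G)$ is the $n\times n$ matrix with zero diagonal, whose $(i,j)$ entry ($i\neq j$) is $-1$ if $v_i$ and $v_j$ are adjacent and $1$ otherwise. For a Hermitian matrix $A$, its energy $\mathcal{E}(A)$ is the sum of the absolute values of its eigenvalues; the Seidel energy of $G$ is $\mathcal{E}(S(G))$. For a tree $T$, $D(T)$ denotes the maximum, over vertices $w$ of $T$, of the number of leaves of $T$ adjacent to $w$. *)

theory Defs
  imports Complex_Main "Jordan_Normal_Form.Char_Poly"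
begin

definition simple_graph :: "nat \<Rightarrow> (nat \<Rightarrow> nat \<Rightarrow> bool) \<Rightarrow> bool" where
  "simple_graph n E \<longleftrightarrow>
     (\<forall>u v. E u v \<longrightarrow> u < n \<and> v < n) \<and>
     (\<forall>u v. E u v \<longrightarrow> E v u) \<and>
     (\<forall>u. \<not> E u u)"

definition connected_graph :: "nat \<Rightarrow> (nat \<Rightarrow> nat \<Rightarrow> bool) \<Rightarrow> bool" where
  "connected_graph n E \<longleftrightarrow> (\<forall>u<n. \<forall>v<n. E\<^sup>*\<^sup>* u v)"

definition is_cycle :: "(nat \<Rightarrow> nat \<Rightarrow> bool) \<Rightarrow> nat list \<Rightarrow> bool" where
  "is_cycle E vs \<longleftrightarrow> length vs \<ge> 3 \<and> distinct vs \<and>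
     (\<forall>i. Suc i < length vs \<longrightarrow> E (vs ! i) (vs ! Suc i)) \<and>
     E (last vs) (hd vs)"

definition is_tree :: "nat \<Rightarrow> (nat \<Rightarrow> nat \<Rightarrow> bool) \<Rightarrow> bool" where
  "is_tree n E \<longleftrightarrow> n \<ge> 1 \<and> simple_graph n E \<and> connected_graph n E \<and>
     (\<nexists>vs. is_cycle E vs)"

definition degree :: "nat \<Rightarrow> (nat \<Rightarrow> nat \<Rightarrow> bool) \<Rightarrow> nat \<Rightarrow> nat" where
  "degree n E v = card {u. u < n \<and> E v u}"

definition is_leaf :: "nat \<Rightarrow> (nat \<Rightarrow> nat \<Rightarrow> bool) \<Rightarrow> nat \<Rightarrow> bool" where
  "is_leaf n E v \<longleftrightarrow> v < n \<and> degree n E v = 1"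

definition max_leaf_nbrs :: "nat \<Rightarrow> (nat \<Rightarrow> nat \<Rightarrow> bool) \<Rightarrow> nat" where
  "max_leaf_nbrs n E = Max ((\<lambda>w. card {u. u < n \<and> E w u \<and> is_leaf n E u}) ` {0..<n})"

definition seidel_matrix :: "nat \<Rightarrow> (nat \<Rightarrow> nat \<Rightarrow> bool) \<Rightarrow> complex mat" where
  "seidel_matrix n E = mat n n (\<lambda>(i, j). if i = j then 0 else if E i j then -1 else 1)"

definition energy :: "complex mat \<Rightarrow> real" where
  "energy A = (\<Sum>x\<in>{x. poly (char_poly A) x = 0}. real (order x (char_poly A)) * cmod x)"

end

theory Submission
  imports Defs "Jordan_Normal_Form.Spectral_Radius" "HOL-Library.Disjoint_Sets"
begin

text \<open>
  The Seidel matrix \<open>S = J - I - 2 A\<close> has trace zero, so half of its energy is the sum of its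
  positive eigenvalues, which dominates the sum of the Rayleigh quotients of \<open>S\<close> over any orthogonal
  family of vectors. Explicit families give two bounds.

  First, the energy of a tree is at least \<open>2 n - 2\<close>: a tree is a star, a double star, or contains an
  induced path on five vertices, and each case has a family of at most three vectors. This settles
  \<open>n - D \<le> 8\<close>.

  Second, partition the vertices into stars with \<open>d\<^sub>1 \<ge> d\<^sub>2 \<ge> \<dots>\<close> leaves. The bottom eigenvectors of the stars
  together with the all-ones vector span a space that yields
  \<open>energy \<ge> 2 n - 8 + 2 (\<Sum>i\<ge>2. 2 sqrt d\<^sub>i - 1)\<close>. If the partition minimises the sum of the squared
  star sizes, then either \<open>d\<^sub>1 \<le> D\<close>, or each leaf of the largest star that is not a leaf of the tree
  has a neighbour in a star of its own with at least \<open>d\<^sub>1 - 1\<close> leaves. In both cases the remaining stars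
  are large enough when \<open>n - D \<ge> 9\<close>.
\<close>

section \<open>Rayleigh quotients and the energy\<close>

text \<open>Since \<open>S\<close> contains \<open>- 2 A\<close>, negative directions of
  \<open>A\<close> are good test vectors for \<open>S\<close>, and the bottom eigenvectors of
  disjoint stars are orthogonal. The obstacle is the all-ones direction: its quotient loses
  \<open>2 * (1 + sqrt d)\<close> to the largest star, with \<open>d\<close> leaves, which uses up
  the whole \<open>2 * sqrt d\<close> that this star earns. Only the vertices outside it count, so
  no star may be needlessly large. Let \<open>K\<close> be the number of these vertices,
  \<open>k = n - D\<close>, and \<open>G\<close> the sum of \<open>2 * sqrt d' - 1\<close> over the
  other stars. The goal becomes \<open>G \<ge> 1 + sqrt (k / 2)\<close>. If
  \<open>d \<le> D\<close>, then \<open>k \<le> K + 1\<close>. Otherwise let \<open>e\<close> leaves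
  of the largest star be non-leaves of the tree: then \<open>k \<le> K + 1 + e\<close>, and their
  neighbouring stars give \<open>2 * e \<le> K\<close>. Either way
  \<open>2 * k \<le> 3 * K + 2\<close>, which suffices once \<open>K \<ge> 7\<close>; for smaller
  \<open>K\<close> only \<open>e = 2\<close> survives. The threshold 8 is where
  \<open>sqrt (2 * (n - D))\<close> reaches 4, the gap between \<open>2 n - 6\<close> and
  \<open>2 n - 2\<close>.\<close>

lemma mat_adjoint_dim [simp]:
  "dim_row (mat_adjoint A) = dim_col A" "dim_col (mat_adjoint A) = dim_row A"
  unfolding mat_adjoint_def by auto

lemma mat_adjoint_carrier [simp, intro]:
  "A \<in> carrier_mat m n \<Longrightarrow> mat_adjoint A \<in> carrier_mat n m"
  unfolding carrier_mat_def by simp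

lemma mat_adjoint_index [simp]:
  "i < dim_col A \<Longrightarrow> j < dim_row A \<Longrightarrow> mat_adjoint A $$ (i, j) = conjugate (A $$ (j, i))"
  unfolding mat_adjoint_def mat_of_rows_def by simp

lemma mat_adjoint_mult:
  fixes A B :: "complex mat"
  assumes "A \<in> carrier_mat m n" "B \<in> carrier_mat n k"
  shows "mat_adjoint (A * B) = mat_adjoint B * mat_adjoint A"
proof (rule eq_matI)
  fix i j assume "i < dim_row (mat_adjoint B * mat_adjoint A)" "j < dim_col (mat_adjoint B * mat_adjoint A)"
  then have "i < k" "j < m" using assms by auto
  then show "mat_adjoint (A * B) $$ (i, j) = (mat_adjoint B * mat_adjoint A) $$ (i, j)"
    using assms by (simp add: scalar_prod_def mult.commute)
qed (use assms in auto)

text \<open>Gram-Schmidt applied to a basis that starts with \<open>v\<close> leaves its first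
  vector unchanged, so normalisation changes it only by the scalar \<open>c\<close>. With an
  eigenvector for \<open>v\<close> this is the deflation step of the diagonalization.\<close>

lemma unitary_with_first_column:
  fixes v :: "complex vec"
  assumes v: "v \<in> carrier_vec n" "v \<noteq> 0\<^sub>v n" and n: "n \<noteq> 0"
  obtains W c where "W \<in> carrier_mat n n" "mat_adjoint W * W = 1\<^sub>m n" "col W 0 = c \<cdot>\<^sub>v v"
proof -
  interpret cof_vec_space n "TYPE(complex)" .
  define b where "b = basis_completion v"
  define ws where "ws = gram_schmidt n b"
  from basis_completion[OF v, folded b_def]
  have dist_b: "distinct b" and indep: "\<not> lin_dep (set b)"
    and b: "set b \<subseteq> carrier_vec n" and hdb: "hd b = v" and len_b: "length b = n" by auto
  from hdb len_b n obtain vs where bv: "b = v # vs" by (cases b, auto)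
  from gram_schmidt_result[OF b dist_b indep refl, folded ws_def]
  have ws: "set ws \<subseteq> carrier_vec n" "corthogonal ws" "length ws = n"
    by (auto simp: len_b)
  from gram_schmidt_hd[OF v(1), of vs, folded bv] have hdws: "hd ws = v" unfolding ws_def .
  define N where "N i = (\<Sum>k<n. (cmod (ws ! i $ k))\<^sup>2)" for i
  have carr: "ws ! i \<in> carrier_vec n" if "i < n" for i
    using ws that by auto
  have prod: "ws ! i \<bullet>c ws ! j = (\<Sum>k<n. ws ! i $ k * cnj (ws ! j $ k))" if "i < n" "j < n" for i j
    using carr[OF that(1)] carr[OF that(2)]
    by (simp add: scalar_prod_def atLeast0LessThan)
  have self: "(\<Sum>k<n. ws ! i $ k * cnj (ws ! i $ k)) = of_real (N i)" for i
    unfolding N_def of_real_sum by (intro sum.cong refl) (simp only: complex_norm_square)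
  have N0: "N i > 0" if "i < n" for i
  proof -
    have "ws ! i \<bullet>c ws ! i \<noteq> 0" using corthogonalD[OF ws(2), of i i] that ws(3) by auto
    then have "N i \<noteq> 0" using prod[OF that that] self by auto
    moreover have "N i \<ge> 0" unfolding N_def by (simp add: sum_nonneg)
    ultimately show ?thesis by simp
  qed
  define W where "W = mat n n (\<lambda>(i, j). ws ! j $ i / of_real (sqrt (N j)))"
  have W: "W \<in> carrier_mat n n" unfolding W_def by simp
  have "mat_adjoint W * W = 1\<^sub>m n"
  proof (rule eq_matI)
    fix i j assume "i < dim_row (1\<^sub>m n :: complex mat)" "j < dim_col (1\<^sub>m n :: complex mat)"
    then have ij: "i < n" "j < n" by auto
    have "(mat_adjoint W * W) $$ (i, j) =
        (\<Sum>k<n. cnj (ws ! i $ k) / of_real (sqrt (N i)) * (ws ! j $ k / of_real (sqrt (N j))))"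
      using ij W by (simp add: scalar_prod_def atLeast0LessThan W_def)
    also have "\<dots> = (\<Sum>k<n. ws ! j $ k * cnj (ws ! i $ k)) / of_real (sqrt (N i) * sqrt (N j))"
      by (simp add: sum_divide_distrib mult_ac)
    also have "\<dots> = (if i = j then 1 else 0)"
    proof (cases "i = j")
      case True
      then show ?thesis using self[of i] N0[OF ij(1)] by simp
    next
      case False
      then have "ws ! j \<bullet>c ws ! i = 0" using corthogonalD[OF ws(2), of j i] ij ws(3) by auto
      then show ?thesis using prod[OF ij(2) ij(1)] False by simp
    qed
    finally show "(mat_adjoint W * W) $$ (i, j) = 1\<^sub>m n $$ (i, j)" using ij by simp
  qed (use W in auto)
  moreover have "col W 0 = (1 / of_real (sqrt (N 0))) \<cdot>\<^sub>v v"
  proof (rule eq_vecI)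
    have "ws ! 0 = v" using hdws n ws(3) by (metis hd_conv_nth length_0_conv)
    then show "col W 0 $ i = ((1 / of_real (sqrt (N 0))) \<cdot>\<^sub>v v) $ i"
      if "i < dim_vec ((1 / of_real (sqrt (N 0))) \<cdot>\<^sub>v v)" for i
      using that n v by (simp add: W_def)
  qed (use v in \<open>simp add: W_def\<close>)
  ultimately show thesis using that W by blast
qed

text \<open>Induction by deflation: conjugation by a unitary matrix whose first column is an
  eigenvector turns the first column into a multiple of a unit vector. The matrix stays Hermitian,
  so its first row has the same shape and a real 1 by 1 block splits off.\<close>

lemma hermitian_diagonalization:
  fixes A :: "complex mat"
  assumes "A \<in> carrier_mat n n" "mat_adjoint A = A"
  shows "\<exists>P d. P \<in> carrier_mat n n \<and> mat_adjoint P * P = 1\<^sub>m n \<and>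
    A = P * mat n n (\<lambda>(i, j). if i = j then of_real (d i :: real) else 0) * mat_adjoint P"
  using assms
proof (induction n arbitrary: A)
  case 0
  then show ?case by (intro exI[of _ A] exI[of _ "\<lambda>_. 0"] conjI eq_matI) auto
next
  case (Suc n)
  note A = Suc.prems(1)
  obtain e where e: "eigenvalue A e"
    using spectrum_non_empty[OF A] unfolding spectrum_def by auto
  then obtain v where v: "v \<in> carrier_vec (Suc n)" "v \<noteq> 0\<^sub>v (Suc n)" "A *\<^sub>v v = e \<cdot>\<^sub>v v"
    unfolding eigenvalue_def eigenvector_def using A by auto
  obtain W c where W: "W \<in> carrier_mat (Suc n) (Suc n)" and WW: "mat_adjoint W * W = 1\<^sub>m (Suc n)"
    and W0: "col W 0 = c \<cdot>\<^sub>v v"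
    using unitary_with_first_column[OF v(1,2)] by auto
  have aW: "mat_adjoint W \<in> carrier_mat (Suc n) (Suc n)" using W by simp
  have WW': "W * mat_adjoint W = 1\<^sub>m (Suc n)"
    by (rule mat_mult_left_right_inverse[OF aW W WW])
  define A' where "A' = mat_adjoint W * A * W"
  have A': "A' \<in> carrier_mat (Suc n) (Suc n)" unfolding A'_def using aW A W by auto
  have adj_adj: "mat_adjoint (mat_adjoint M) = M" for M :: "complex mat"
    by (rule eq_matI) auto
  have herm': "mat_adjoint A' = A'"
    unfolding A'_def
    using mat_adjoint_mult[OF mult_carrier_mat[OF aW A] W] mat_adjoint_mult[OF aW A]
      Suc.prems(2) assoc_mult_mat[OF aW A W]
    by (simp add: adj_adj)
  have A_eq: "A = W * A' * mat_adjoint W"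
  proof -
    have "W * A' * mat_adjoint W = (W * mat_adjoint W) * A * (W * mat_adjoint W)"
      unfolding A'_def using W aW A
      by (simp add: assoc_mult_mat[of _ "Suc n" "Suc n" _ "Suc n" _ "Suc n"]
        mult_carrier_mat[of _ "Suc n" "Suc n" _ "Suc n"])
    also have "\<dots> = A" using WW' A by simp
    finally show ?thesis by simp
  qed
  have col0: "A' $$ (i, 0) = (if i = 0 then e else 0)" if i: "i < Suc n" for i
  proof -
    have eq: "A *\<^sub>v col W 0 = e \<cdot>\<^sub>v col W 0"
      unfolding W0 using v A by (simp add: mult_mat_vec smult_smult_assoc mult.commute)
    have "A' $$ (i, 0) = (mat_adjoint W * (A * W)) $$ (i, 0)"
      unfolding A'_def using assoc_mult_mat[OF aW A W] by simp
    also have "\<dots> = row (mat_adjoint W) i \<bullet> col (A * W) 0"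
      using i W A by (subst index_mult_mat) auto
    also have "col (A * W) 0 = e \<cdot>\<^sub>v col W 0"
      using eq col_mult2[OF A W] by simp
    also have "row (mat_adjoint W) i \<bullet> (e \<cdot>\<^sub>v col W 0) = e * (row (mat_adjoint W) i \<bullet> col W 0)"
      using W by (auto intro!: scalar_prod_smult_distrib)
    also have "row (mat_adjoint W) i \<bullet> col W 0 = (mat_adjoint W * W) $$ (i, 0)"
      using i W by simp
    also have "\<dots> = (if i = 0 then 1 else 0)" using WW i by simp
    finally show ?thesis by simp
  qed
  have conjA': "A' $$ (i, j) = cnj (A' $$ (j, i))" if "i < Suc n" "j < Suc n" for i j
    using herm' A' that mat_adjoint_index[of i A' j] by auto
  have e_real: "of_real (Re e) = e"
    using conjA'[of 0 0] col0[of 0] by (simp add: complex_eq_iff)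
  define B where "B = mat n n (\<lambda>(i, j). A' $$ (Suc i, Suc j))"
  have B: "B \<in> carrier_mat n n" unfolding B_def by simp
  have "mat_adjoint B = B"
    by (rule eq_matI) (auto simp: B_def conjA'[symmetric])
  from Suc.IH[OF B this] obtain P d where P: "P \<in> carrier_mat n n"
    and PP: "mat_adjoint P * P = 1\<^sub>m n"
    and BP: "B = P * mat n n (\<lambda>(i, j). if i = j then of_real (d i :: real) else 0) * mat_adjoint P"
    by blast
  let ?D = "mat n n (\<lambda>(i, j). if i = j then complex_of_real (d i) else 0)"
  define F where "F M = four_block_mat (1\<^sub>m 1) (0\<^sub>m 1 n) (0\<^sub>m n 1) M" for M :: "complex mat"
  define E where "E = mat 1 1 (\<lambda>_. e)"
  define d' where "d' i = (case i of 0 \<Rightarrow> Re e | Suc j \<Rightarrow> d j)" for i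
  let ?D' = "mat (Suc n) (Suc n) (\<lambda>(i, j). if i = j then complex_of_real (d' i) else 0)"
  have F: "F M \<in> carrier_mat (Suc n) (Suc n)" if "M \<in> carrier_mat n n" for M
    using that unfolding F_def by auto
  have A'_block: "A' = four_block_mat E (0\<^sub>m 1 n) (0\<^sub>m n 1) B"
  proof (rule eq_matI)
    fix i j assume ij: "i < dim_row (four_block_mat E (0\<^sub>m 1 n) (0\<^sub>m n 1) B)"
      "j < dim_col (four_block_mat E (0\<^sub>m 1 n) (0\<^sub>m n 1) B)"
    then show "A' $$ (i, j) = four_block_mat E (0\<^sub>m 1 n) (0\<^sub>m n 1) B $$ (i, j)"
      using col0[of i] conjA'[of 0 j] col0[of j] e_real
      by (cases i; cases j) (auto simp: E_def B_def)
  qed (use A' in \<open>auto simp: E_def B_def\<close>)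
  have D'_block: "?D' = four_block_mat E (0\<^sub>m 1 n) (0\<^sub>m n 1) ?D"
    by (rule eq_matI) (auto simp: E_def d'_def e_real split: nat.splits)
  have aF: "mat_adjoint (F P) = F (mat_adjoint P)"
    by (rule eq_matI) (use P in \<open>auto simp: F_def\<close>)
  have aP: "mat_adjoint P \<in> carrier_mat n n" using P by simp
  have E1: "E \<in> carrier_mat 1 1" by (simp add: E_def)
  have "F P * ?D' = four_block_mat E (0\<^sub>m 1 n) (0\<^sub>m n 1) (P * ?D)"
    unfolding D'_block F_def
    by (subst mult_four_block_mat[of _ 1 1 _ n _ n _ _ 1 _ n]) (use P E1 in auto)
  then have "F P * ?D' * F (mat_adjoint P) = four_block_mat E (0\<^sub>m 1 n) (0\<^sub>m n 1) (P * ?D * mat_adjoint P)"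
    unfolding F_def
    by simp (subst mult_four_block_mat[of _ 1 1 _ n _ n _ _ 1 _ n]; use P aP E1 in auto)
  then have FD: "F P * ?D' * F (mat_adjoint P) = A'"
    unfolding A'_block using BP by simp
  have FF: "mat_adjoint (F P) * F P = 1\<^sub>m (Suc n)"
  proof -
    have "F (mat_adjoint P) * F P = four_block_mat (1\<^sub>m 1) (0\<^sub>m 1 n) (0\<^sub>m n 1) (mat_adjoint P * P)"
      unfolding F_def
      by (subst mult_four_block_mat[of _ 1 1 _ n _ n _ _ 1 _ n]) (use P aP in auto)
    then show ?thesis unfolding aF PP by simp
  qed
  let ?Q = "W * F P"
  have Q: "?Q \<in> carrier_mat (Suc n) (Suc n)" using W F[OF P] by auto
  have aQ: "mat_adjoint ?Q = F (mat_adjoint P) * mat_adjoint W"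
    using mat_adjoint_mult[OF W F[OF P]] aF by simp
  have D'c: "?D' \<in> carrier_mat (Suc n) (Suc n)" by simp
  have "mat_adjoint ?Q * ?Q = F (mat_adjoint P) * (mat_adjoint W * W) * F P"
    unfolding aQ using W aW F[OF P] F[OF aP]
    by (simp add: assoc_mult_mat[of _ "Suc n" "Suc n" _ "Suc n" _ "Suc n"]
        mult_carrier_mat[of _ "Suc n" "Suc n" _ "Suc n"])
  then have "mat_adjoint ?Q * ?Q = 1\<^sub>m (Suc n)"
    unfolding WW using FF F[OF aP] by (simp add: aF)
  moreover have "?Q * ?D' * mat_adjoint ?Q = W * (F P * ?D' * F (mat_adjoint P)) * mat_adjoint W"
    unfolding aQ using W aW F[OF P] F[OF aP] D'c
    by (simp add: assoc_mult_mat[of _ "Suc n" "Suc n" _ "Suc n" _ "Suc n"]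
        mult_carrier_mat[of _ "Suc n" "Suc n" _ "Suc n"])
  then have "A = ?Q * ?D' * mat_adjoint ?Q" unfolding FD A_eq[symmetric] by simp
  ultimately show ?case using Q by blast
qed


section \<open>Energy in terms of eigenvalues, and Ky Fan's principle\<close>

text \<open>The order of a root in a product of linear factors is its number of occurrences in the
  list, so the weighted sum over distinct roots becomes a sum with repetition.\<close>

lemma energy_prod_list:
  assumes "char_poly A = (\<Prod>a\<leftarrow>as. [:- a, 1:])"
  shows "energy A = (\<Sum>a\<leftarrow>as. cmod a)"
proof -
  let ?p = "\<lambda>as::complex list. \<Prod>a\<leftarrow>as. [:- a, 1:]"
  have p0: "?p bs \<noteq> 0" for bs
    by (simp add: prod_list_zero_iff image_iff)
  have ord: "order x (?p bs) = count_list bs x" for x bs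
  proof (induction bs)
    case (Cons b bs)
    have "order x [:- b, 1:] = (if b = x then 1 else 0)"
      by (cases "b = x") (auto simp: order_linear' intro: order_0I)
    moreover have "order x ([:- b, 1:] * ?p bs) = order x [:- b, 1:] + order x (?p bs)"
      by (intro order_mult) (use p0[of bs] p0[of "[b]"] in \<open>simp del: mult_pCons_left\<close>)
    ultimately show ?case using Cons by simp
  qed (simp add: order_0I)
  have roots: "{x. poly (?p as) x = 0} = set as"
    by (auto simp: poly_prod_list o_def prod_list_zero_iff)
  have "(\<Sum>x\<in>X. real (count_list bs x) * cmod x) = (\<Sum>a\<leftarrow>bs. cmod a)"
    if "finite X" "set bs \<subseteq> X" for X bs
    using that(2)
  proof (induction bs)
    case (Cons b bs)
    have "(\<Sum>x\<in>X. real (count_list (b # bs) x) * cmod x) =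
        (\<Sum>x\<in>X. (if x = b then cmod b else 0) + real (count_list bs x) * cmod x)"
      by (intro sum.cong refl) (auto simp: algebra_simps)
    then show ?case using Cons that(1) by (simp add: sum.distrib)
  qed simp
  then show ?thesis
    unfolding energy_def assms roots ord by simp
qed

text \<open>\<open>y\<close> is the projection of \<open>x\<close> onto the span of the family. The
  inner products of \<open>y\<close> with \<open>x\<close> and with itself both equal the left-hand
  side, so the claim is that \<open>x - y\<close> has nonnegative squared norm.\<close>

lemma bessel_inequality:
  fixes q :: "'i \<Rightarrow> nat \<Rightarrow> real"
  assumes I: "finite I"
    and orth: "\<And>i j. i \<in> I \<Longrightarrow> j \<in> I \<Longrightarrow> i \<noteq> j \<Longrightarrow> (\<Sum>v<n. q i v * q j v) = 0"
  shows "(\<Sum>i\<in>I. (\<Sum>v<n. q i v * x v)\<^sup>2 / (\<Sum>v<n. (q i v)\<^sup>2)) \<le> (\<Sum>v<n. (x v)\<^sup>2)"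
proof -
  define N where "N i = (\<Sum>v<n. (q i v)\<^sup>2)" for i
  define a where "a i = (\<Sum>v<n. q i v * x v)" for i
  define c where "c i = a i / N i" for i
  define y where "y v = (\<Sum>i\<in>I. c i * q i v)" for v
  have xy: "(\<Sum>v<n. x v * y v) = (\<Sum>i\<in>I. (a i)\<^sup>2 / N i)"
  proof -
    have "(\<Sum>v<n. x v * y v) = (\<Sum>v<n. \<Sum>i\<in>I. c i * (q i v * x v))"
      unfolding y_def by (simp add: sum_distrib_left mult_ac)
    also have "\<dots> = (\<Sum>i\<in>I. c i * a i)"
      unfolding a_def by (subst sum.swap) (simp add: sum_distrib_left)
    finally show ?thesis by (simp add: c_def power2_eq_square)
  qed
  have qy: "(\<Sum>v<n. q i v * y v) = c i * N i" if i: "i \<in> I" for i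
  proof -
    have "(\<Sum>v<n. q i v * y v) = (\<Sum>v<n. \<Sum>j\<in>I. c j * (q i v * q j v))"
      unfolding y_def by (simp add: sum_distrib_left mult_ac)
    also have "\<dots> = (\<Sum>j\<in>I. c j * (\<Sum>v<n. q i v * q j v))"
      by (subst sum.swap) (simp add: sum_distrib_left)
    also have "\<dots> = (\<Sum>j\<in>I. if j = i then c i * N i else 0)"
      by (intro sum.cong refl) (use orth i in \<open>auto simp: N_def power2_eq_square\<close>)
    also have "\<dots> = c i * N i" using I i by simp
    finally show ?thesis .
  qed
  have yy: "(\<Sum>v<n. y v * y v) = (\<Sum>i\<in>I. (a i)\<^sup>2 / N i)"
  proof -
    have "(\<Sum>v<n. y v * y v) = (\<Sum>v<n. \<Sum>i\<in>I. c i * (q i v * y v))"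
      by (intro sum.cong refl, subst (1) y_def) (simp only: sum_distrib_right mult.assoc)
    also have "\<dots> = (\<Sum>i\<in>I. c i * (\<Sum>v<n. q i v * y v))"
      by (subst sum.swap) (simp add: sum_distrib_left)
    also have "\<dots> = (\<Sum>i\<in>I. (a i)\<^sup>2 / N i)"
      by (intro sum.cong refl) (simp add: qy c_def power2_eq_square)
    finally show ?thesis .
  qed
  have "0 \<le> (\<Sum>v<n. (x v - y v)\<^sup>2)" by (simp add: sum_nonneg)
  also have "\<dots> = (\<Sum>v<n. (x v)\<^sup>2) - 2 * (\<Sum>v<n. x v * y v) + (\<Sum>v<n. y v * y v)"
    by (simp add: power2_eq_square algebra_simps sum.distrib sum_subtractf sum_distrib_left)
  finally show ?thesis unfolding xy yy N_def a_def by simp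
qed

text \<open>Ky Fan's variational principle for the positive part of the spectrum; as the trace
  vanishes, that part carries half of the energy. A zero vector contributes \<open>0 / 0 = 0\<close>.\<close>

lemma sum_rayleigh_quotients_le_energy:
  fixes s :: "nat \<Rightarrow> nat \<Rightarrow> real" and q :: "'i \<Rightarrow> nat \<Rightarrow> real"
  assumes sym: "\<And>u v. u < n \<Longrightarrow> v < n \<Longrightarrow> s u v = s v u"
    and trace: "(\<Sum>v<n. s v v) = 0"
    and I: "finite I"
    and orth: "\<And>i j. i \<in> I \<Longrightarrow> j \<in> I \<Longrightarrow> i \<noteq> j \<Longrightarrow> (\<Sum>v<n. q i v * q j v) = 0"
  shows "2 * (\<Sum>i\<in>I. (\<Sum>u<n. \<Sum>v<n. q i u * q i v * s u v) / (\<Sum>v<n. (q i v)\<^sup>2))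
    \<le> energy (mat n n (\<lambda>(u, v). complex_of_real (s u v)))"
proof -
  define A where "A = mat n n (\<lambda>(u, v). complex_of_real (s u v))"
  have A: "A \<in> carrier_mat n n" unfolding A_def by simp
  have "mat_adjoint A = A"
    by (rule eq_matI) (use sym in \<open>auto simp: A_def\<close>)
  from hermitian_diagonalization[OF A this] obtain P d where P: "P \<in> carrier_mat n n"
    and PP: "mat_adjoint P * P = 1\<^sub>m n"
    and AP: "A = P * mat n n (\<lambda>(i, j). if i = j then of_real (d i :: real) else 0) * mat_adjoint P"
    by blast
  let ?D = "mat n n (\<lambda>(i, j). if i = j then complex_of_real (d i) else 0)"
  have aP: "mat_adjoint P \<in> carrier_mat n n" using P by simp
  have PP': "P * mat_adjoint P = 1\<^sub>m n"
    by (rule mat_mult_left_right_inverse[OF aP P PP])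
  have "similar_mat_wit A ?D P (mat_adjoint P)"
    by (rule similar_mat_witI[of _ _ n]) (use A P aP PP PP' AP in auto)
  then have "char_poly A = char_poly ?D"
    by (intro char_poly_similar) (auto simp: similar_mat_def)
  also have "\<dots> = (\<Prod>a\<leftarrow>diag_mat ?D. [:- a, 1:])"
    by (rule char_poly_upper_triangular[of _ n]) auto
  finally have "energy A = (\<Sum>a\<leftarrow>diag_mat ?D. cmod a)"
    by (rule energy_prod_list)
  also have "diag_mat ?D = map (\<lambda>i. complex_of_real (d i)) [0..<n]"
    by (auto simp: diag_mat_def)
  finally have energy: "energy A = (\<Sum>j<n. \<bar>d j\<bar>)"
    by (simp add: o_def interv_sum_list_conv_sum_set_nat atLeast0LessThan)
  have s_eq: "complex_of_real (s u v) = (\<Sum>j<n. of_real (d j) * (P $$ (u, j) * cnj (P $$ (v, j))))"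
    if "u < n" "v < n" for u v
  proof -
    have "complex_of_real (s u v) = A $$ (u, v)" using that by (simp add: A_def)
    also have "\<dots> = (\<Sum>j<n. (P * ?D) $$ (u, j) * mat_adjoint P $$ (j, v))"
      unfolding AP using that P aP by (subst index_mult_mat) (auto simp: scalar_prod_def atLeast0LessThan)
    also have "\<dots> = (\<Sum>j<n. of_real (d j) * (P $$ (u, j) * cnj (P $$ (v, j))))"
    proof (intro sum.cong refl)
      fix j assume j: "j \<in> {..<n}"
      have "(P * ?D) $$ (u, j) = (\<Sum>k<n. P $$ (u, k) * (if k = j then of_real (d k) else 0))"
        using that P j by (auto simp: scalar_prod_def atLeast0LessThan)
      also have "\<dots> = P $$ (u, j) * of_real (d j)" using j by (simp add: if_distrib cong: if_cong)
      finally show "(P * ?D) $$ (u, j) * mat_adjoint P $$ (j, v) =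
          of_real (d j) * (P $$ (u, j) * cnj (P $$ (v, j)))"
        using j that P by simp
    qed
    finally show ?thesis .
  qed
  have col_norm: "(\<Sum>v<n. (cmod (P $$ (v, j)))\<^sup>2) = 1" if "j < n" for j
  proof -
    have "(\<Sum>v<n. cnj (P $$ (v, j)) * P $$ (v, j)) = (mat_adjoint P * P) $$ (j, j)"
      using that P by (simp add: scalar_prod_def atLeast0LessThan)
    also have "\<dots> = 1" using PP that by simp
    finally have "(\<Sum>v<n. P $$ (v, j) * cnj (P $$ (v, j))) = 1" by (simp add: mult.commute)
    then have "complex_of_real (\<Sum>v<n. (cmod (P $$ (v, j)))\<^sup>2) = 1"
      unfolding of_real_sum complex_norm_square .
    then show ?thesis using of_real_eq_1_iff by blast
  qed
  have form: "(\<Sum>u<n. \<Sum>v<n. x u * x v * s u v) =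
      (\<Sum>j<n. d j * (cmod (\<Sum>v<n. of_real (x v) * P $$ (v, j)))\<^sup>2)" for x :: "nat \<Rightarrow> real"
  proof -
    have "complex_of_real (\<Sum>u<n. \<Sum>v<n. x u * x v * s u v) =
        (\<Sum>u<n. \<Sum>v<n. \<Sum>j<n. of_real (d j) * ((of_real (x u) * P $$ (u, j)) * (of_real (x v) * cnj (P $$ (v, j)))))"
      unfolding of_real_sum
      by (intro sum.cong refl) (simp add: s_eq sum_distrib_left mult_ac)
    also have "\<dots> = (\<Sum>u<n. \<Sum>j<n. \<Sum>v<n. of_real (d j) * ((of_real (x u) * P $$ (u, j)) * (of_real (x v) * cnj (P $$ (v, j)))))"
      by (intro sum.cong refl sum.swap)
    also have "\<dots> = (\<Sum>j<n. \<Sum>u<n. \<Sum>v<n. of_real (d j) * ((of_real (x u) * P $$ (u, j)) * (of_real (x v) * cnj (P $$ (v, j)))))"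
      by (rule sum.swap)
    also have "\<dots> = (\<Sum>j<n. of_real (d j) * ((\<Sum>u<n. of_real (x u) * P $$ (u, j)) * (\<Sum>v<n. of_real (x v) * cnj (P $$ (v, j)))))"
      by (subst sum_product) (simp only: sum_distrib_left)
    also have "\<dots> = (\<Sum>j<n. of_real (d j) * of_real ((cmod (\<Sum>v<n. of_real (x v) * P $$ (v, j)))\<^sup>2))"
      by (intro sum.cong refl arg_cong2[where f = "(*)"]) (simp only: complex_norm_square, simp)
    also have "\<dots> = complex_of_real (\<Sum>j<n. d j * (cmod (\<Sum>v<n. of_real (x v) * P $$ (v, j)))\<^sup>2)"
      by simp
    finally show ?thesis using of_real_eq_iff by blast
  qed
  have tr: "(\<Sum>j<n. d j) = 0"
  proof -
    have "complex_of_real (\<Sum>v<n. s v v) = (\<Sum>v<n. \<Sum>j<n. of_real (d j) * of_real ((cmod (P $$ (v, j)))\<^sup>2))"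
      unfolding of_real_sum by (intro sum.cong refl) (simp add: s_eq complex_norm_square del: of_real_power)
    also have "\<dots> = complex_of_real (\<Sum>j<n. d j * (\<Sum>v<n. (cmod (P $$ (v, j)))\<^sup>2))"
      by (subst sum.swap) (simp add: sum_distrib_left)
    finally have "(\<Sum>v<n. s v v) = (\<Sum>j<n. d j * (\<Sum>v<n. (cmod (P $$ (v, j)))\<^sup>2))"
      using of_real_eq_iff by blast
    then show ?thesis using trace col_norm by simp
  qed
  define N where "N i = (\<Sum>v<n. (q i v)\<^sup>2)" for i
  \<comment> \<open>For nonzero \<open>q i\<close> this is the squared cosine of the angle between
    \<open>q i\<close> and the \<open>j\<close>-th eigenvector.\<close>
  define w where "w i j = (cmod (\<Sum>v<n. of_real (q i v) * P $$ (v, j)))\<^sup>2 / N i" for i j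
  have w0: "w i j \<ge> 0" for i j unfolding w_def N_def by (simp add: sum_nonneg)
  have w1: "(\<Sum>i\<in>I. w i j) \<le> 1" if "j < n" for j
  proof -
    \<comment> \<open>Bessel's inequality is available for real vectors, so it is applied to the
      real and the imaginary part of the eigenvector separately.\<close>
    have cm: "(cmod (\<Sum>v<n. of_real (q i v) * P $$ (v, j)))\<^sup>2 =
      (\<Sum>v<n. q i v * Re (P $$ (v, j)))\<^sup>2 + (\<Sum>v<n. q i v * Im (P $$ (v, j)))\<^sup>2" for i
      by (simp add: cmod_power2)
    have "(\<Sum>i\<in>I. w i j) = (\<Sum>i\<in>I. (\<Sum>v<n. q i v * Re (P $$ (v, j)))\<^sup>2 / (\<Sum>v<n. (q i v)\<^sup>2))
        + (\<Sum>i\<in>I. (\<Sum>v<n. q i v * Im (P $$ (v, j)))\<^sup>2 / (\<Sum>v<n. (q i v)\<^sup>2))"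
      unfolding w_def N_def cm by (simp add: add_divide_distrib sum.distrib)
    also have "\<dots> \<le> (\<Sum>v<n. (Re (P $$ (v, j)))\<^sup>2) + (\<Sum>v<n. (Im (P $$ (v, j)))\<^sup>2)"
      by (intro add_mono bessel_inequality I orth)
    also have "\<dots> = 1" using col_norm[OF that] by (simp add: cmod_power2 sum.distrib)
    finally show ?thesis .
  qed
  have "(\<Sum>i\<in>I. (\<Sum>u<n. \<Sum>v<n. q i u * q i v * s u v) / N i) = (\<Sum>i\<in>I. \<Sum>j<n. d j * w i j)"
    unfolding form w_def by (simp add: sum_divide_distrib)
  also have "\<dots> = (\<Sum>j<n. d j * (\<Sum>i\<in>I. w i j))"
    by (subst sum.swap) (simp add: sum_distrib_left)
  \<comment> \<open>A weight between 0 and 1 turns \<open>d j\<close> into at most its positive part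
    \<open>(\<bar>d j\<bar> + d j) / 2\<close>.\<close>
  also have "\<dots> \<le> (\<Sum>j<n. (\<bar>d j\<bar> + d j) / 2)"
  proof (rule sum_mono)
    fix j assume "j \<in> {..<n}"
    then have "(\<Sum>i\<in>I. w i j) \<le> 1" "(\<Sum>i\<in>I. w i j) \<ge> 0" using w1 w0 by (auto intro: sum_nonneg)
    then show "d j * (\<Sum>i\<in>I. w i j) \<le> (\<bar>d j\<bar> + d j) / 2"
      by (cases "d j \<ge> 0") (auto simp: mult_left_le mult_nonpos_nonneg)
  qed
  also have "\<dots> = energy A / 2"
    unfolding energy using tr by (simp add: sum_divide_distrib[symmetric] sum.distrib)
  finally show ?thesis unfolding A_def N_def by simp
qed

section \<open>Trees\<close>

text \<open>An end of a longest path works: all its neighbours lie on the path, and two of them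
  would close a cycle.\<close>

lemma ex_vertex_degree_le_1:
  assumes V: "finite V" "V \<noteq> {}"
    and sym: "\<And>u v. E u v \<Longrightarrow> E v u" and irrefl: "\<And>u. \<not> E u u"
    and acyc: "\<nexists>vs. is_cycle E vs"
  shows "\<exists>x\<in>V. \<forall>y\<in>V. \<forall>z\<in>V. E x y \<longrightarrow> E x z \<longrightarrow> y = z"
proof (rule ccontr)
  assume no: "\<not> ?thesis"
  define path where "path xs \<longleftrightarrow> xs \<noteq> [] \<and> distinct xs \<and> set xs \<subseteq> V \<and> successively E xs" for xs
  obtain x0 where "x0 \<in> V" using V by blast
  then have "path [x0]" by (simp add: path_def)
  moreover have bound: "length xs < Suc (card V)" if "path xs" for xs
    using that V card_mono[of V "set xs"] by (simp add: path_def distinct_card less_Suc_eq_le)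
  ultimately obtain xs where xs: "path xs" and max: "\<And>ys. path ys \<Longrightarrow> length ys \<le> length xs"
    using ex_has_greatest_nat[of path "[x0]" length "Suc (card V)"] by blast
  obtain x ys where xys: "xs = x # ys" using xs by (cases xs) (auto simp: path_def)
  have nbr: "y \<in> set ys" if "y \<in> V" "E x y" for y
  proof (rule ccontr)
    assume "y \<notin> set ys"
    then have "path (y # xs)"
      using xs that irrefl sym unfolding path_def xys by (auto simp: successively_Cons)
    then show False using max[of "y # xs"] by simp
  qed
  have "x \<in> V" using xs by (simp add: path_def xys)
  then obtain y z where yz: "y \<in> V" "z \<in> V" "E x y" "E x z" "y \<noteq> z" using no by blast
  then obtain i j where "i < length ys" "j < length ys" "ys ! i = y" "ys ! j = z"
    using nbr by (metis in_set_conv_nth)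
  \<comment> \<open>One of the two neighbours is not the next vertex of the path; closing the path
    there leaves at least three vertices on the cycle.\<close>
  then obtain k where k: "k < length ys" "k \<ge> 1" "E x (ys ! k)"
    using yz by (metis less_one linorder_not_le)
  let ?c = "take (Suc (Suc k)) xs"
  have len: "length ?c = Suc (Suc k)" using k by (simp add: xys)
  have "is_cycle E ?c"
    unfolding is_cycle_def
  proof (intro conjI allI impI)
    fix i assume "Suc i < length ?c"
    then have i: "Suc i < length xs" "i < Suc (Suc k)" "Suc i < Suc (Suc k)" using len by auto
    then have "E (xs ! i) (xs ! Suc i)"
      using xs by (auto simp: path_def successively_conv_nth)
    then show "E (?c ! i) (?c ! Suc i)" using i by (simp only: nth_take)
  next
    have "last ?c = ?c ! Suc k" using len by (subst last_conv_nth) auto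
    also have "\<dots> = ys ! k" using k by (simp add: xys)
    finally show "E (last ?c) (hd ?c)" using k(3) sym by (simp add: xys)
  qed (use xs len k in \<open>auto simp: path_def xys dest: in_set_takeD\<close>)
  then show False using acyc by blast
qed

text \<open>Induction by removing a vertex with at most one neighbour, which becomes its parent
  under \<open>p\<close>. Thus every edge points from a child to its parent and every vertex has at
  most one outgoing edge. Where there is no parent the value of \<open>p\<close> is arbitrary, so
  uses of \<open>p u\<close> have to be guarded by adjacency.\<close>

lemma forest_colouring_and_orientation:
  assumes V: "finite V"
    and sym: "\<And>u v. E u v \<Longrightarrow> E v u" and irrefl: "\<And>u. \<not> E u u"
    and acyc: "\<nexists>vs. is_cycle E vs"
  shows "\<exists>(col :: nat \<Rightarrow> bool) p. \<forall>u\<in>V. \<forall>v\<in>V. E u v \<longrightarrow> col u \<noteq> col v \<and> (p u = v \<or> p v = u)"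
  using V
proof (induction V rule: finite_remove_induct)
  case empty
  then show ?case by simp
next
  case (remove V)
  obtain x where x: "x \<in> V" "\<And>y z. y \<in> V \<Longrightarrow> z \<in> V \<Longrightarrow> E x y \<Longrightarrow> E x z \<Longrightarrow> y = z"
    using ex_vertex_degree_le_1[of V E] remove.hyps sym irrefl acyc by metis
  obtain col :: "nat \<Rightarrow> bool" and p where IH:
    "\<And>u v. u \<in> V - {x} \<Longrightarrow> v \<in> V - {x} \<Longrightarrow> E u v \<Longrightarrow> col u \<noteq> col v \<and> (p u = v \<or> p v = u)"
    using remove.IH[OF x(1)] by blast
  show ?case
  proof (cases "\<exists>y\<in>V. E x y")
    case True
    then obtain y where y: "y \<in> V" "E x y" by blast
    show ?thesis
    proof (intro exI ballI impI)
      fix u v assume uv: "u \<in> V" "v \<in> V" "E u v"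
      have "x \<noteq> y" using y irrefl by auto
      show "(col(x := \<not> col y)) u \<noteq> (col(x := \<not> col y)) v \<and> ((p(x := y)) u = v \<or> (p(x := y)) v = u)"
      proof (cases "u = x \<or> v = x")
        case True
        then have "u = x \<and> v = y \<or> v = x \<and> u = y"
          using uv x(2) y sym by blast
        then show ?thesis using \<open>x \<noteq> y\<close> by auto
      next
        case False
        then show ?thesis using IH[of u v] uv by auto
      qed
    qed
  next
    case False
    then have "\<not> E v x" "\<not> E x v" if "v \<in> V" for v using that sym by blast+
    then show ?thesis using IH by (intro exI[of _ col] exI[of _ p]) (metis DiffI singletonD)
  qed
qed

text \<open>The quadratic form of the adjacency matrix; every edge enters twice.\<close>

definition edge_form :: "nat \<Rightarrow> (nat \<Rightarrow> nat \<Rightarrow> bool) \<Rightarrow> (nat \<Rightarrow> real) \<Rightarrow> real" where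
  "edge_form n E x = (\<Sum>u<n. x u * (\<Sum>v | E u v. x v))"

section \<open>Basic facts on trees, and test vectors for their Seidel matrices\<close>

locale finite_tree =
  fixes n :: nat and E :: "nat \<Rightarrow> nat \<Rightarrow> bool"
  assumes tree: "is_tree n E"
begin

lemma edge_less: "E u v \<Longrightarrow> u < n" "E u v \<Longrightarrow> v < n"
  using tree unfolding is_tree_def simple_graph_def by blast+

lemma edge_sym: "E u v \<Longrightarrow> E v u"
  using tree unfolding is_tree_def simple_graph_def by blast

lemma edge_irrefl [simp]: "\<not> E u u"
  using tree unfolding is_tree_def simple_graph_def by blast

lemma acyclic: "\<not> is_cycle E vs"
  using tree unfolding is_tree_def by blast

lemma finite_nbrs [simp]: "finite {v. E u v}"
  by (rule finite_subset[of _ "{..<n}"]) (auto dest: edge_less)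

lemma no_triangle: "E a b \<Longrightarrow> E b c \<Longrightarrow> E c a \<Longrightarrow> False"
  using acyclic[of "[a, b, c]"]
  by (auto simp: is_cycle_def nth_Cons less_Suc_eq numeral_3_eq_3 split: nat.splits)

lemma no_square: "E a b \<Longrightarrow> E b c \<Longrightarrow> E c d \<Longrightarrow> E d a \<Longrightarrow> a = c \<or> b = d"
  using acyclic[of "[a, b, c, d]"]
  by (auto simp: is_cycle_def nth_Cons less_Suc_eq numeral_3_eq_3 split: nat.splits)

lemma no_pentagon:
  "E a b \<Longrightarrow> E b c \<Longrightarrow> E c d \<Longrightarrow> E d e \<Longrightarrow> E e a \<Longrightarrow> \<not> distinct [a, b, c, d, e]"
  using acyclic[of "[a, b, c, d, e]"]
  by (auto simp: is_cycle_def nth_Cons less_Suc_eq numeral_3_eq_3 split: nat.splits)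

lemma closed_set_all:
  assumes "c < n" "c \<in> S" "\<And>u v. u \<in> S \<Longrightarrow> E u v \<Longrightarrow> v \<in> S"
  shows "{..<n} \<subseteq> S"
proof
  fix v assume "v \<in> {..<n}"
  then have "E\<^sup>*\<^sup>* c v"
    using tree assms(1) unfolding is_tree_def connected_graph_def by blast
  then show "v \<in> S" by (induction rule: rtranclp_induct) (use assms in auto)
qed

lemma ex_neighbour:
  assumes "n \<ge> 2" "v < n"
  obtains u where "E v u"
proof -
  have "\<exists>u. E v u"
  proof (rule ccontr)
    assume "\<nexists>u. E v u"
    then have "{..<n} \<subseteq> {v}" using closed_set_all[of v "{v}"] assms by blast
    then show False using card_mono[of "{v}" "{..<n}"] assms by simp
  qed
  then show thesis using that by blast
qed

lemma colouring_and_orientation: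
  obtains col :: "nat \<Rightarrow> bool" and p
  where "\<And>u v. E u v \<Longrightarrow> col u \<noteq> col v" "\<And>u v. E u v \<Longrightarrow> p u = v \<or> p v = u"
  using forest_colouring_and_orientation[of "{..<n}" E] edge_sym edge_irrefl acyclic edge_less
  by (metis finite_lessThan lessThan_iff)

lemma max_leaf_nbrs_ge:
  assumes "w < n"
  shows "card {u. u < n \<and> E w u \<and> is_leaf n E u} \<le> max_leaf_nbrs n E"
  unfolding max_leaf_nbrs_def using assms by (intro Max_ge) auto

lemma is_leafI:
  assumes "E u v" "\<And>w. E u w \<Longrightarrow> w = v"
  shows "is_leaf n E u"
proof -
  have "{w. w < n \<and> E u w} = {v}" using assms edge_less by blast
  then show ?thesis using edge_less(1)[OF assms(1)] by (simp add: is_leaf_def degree_def)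
qed

lemma max_leaf_nbrs_pos:
  assumes "n \<ge> 2"
  shows "max_leaf_nbrs n E \<ge> 1"
proof -
  obtain x where x: "x < n" "\<And>y z. E x y \<Longrightarrow> E x z \<Longrightarrow> y = z"
    using ex_vertex_degree_le_1[of "{..<n}" E] assms edge_sym edge_irrefl acyclic edge_less
    by (metis finite_lessThan lessThan_empty_iff lessThan_iff not_numeral_le_zero)
  obtain y where y: "E x y" using ex_neighbour[OF assms x(1)] .
  then have "is_leaf n E x" using x by (intro is_leafI) auto
  then have "{x} \<subseteq> {u. u < n \<and> E y u \<and> is_leaf n E u}" using x y edge_sym by auto
  then have "1 \<le> card {u. u < n \<and> E y u \<and> is_leaf n E u}"
    using card_mono[of "{u. u < n \<and> E y u \<and> is_leaf n E u}" "{x}"] by simp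
  also have "\<dots> \<le> max_leaf_nbrs n E" using y edge_less by (intro max_leaf_nbrs_ge)
  finally show ?thesis .
qed

lemma seidel_matrix_eq:
  "seidel_matrix n E =
    mat n n (\<lambda>(u, v). complex_of_real (if u = v then 0 else if E u v then -1 else 1))"
  unfolding seidel_matrix_def by (rule eq_matI) auto

text \<open>In \<open>S = J - I - 2 A\<close> the part \<open>J\<close> yields the squared
  coordinate sum, and \<open>- I\<close> yields \<open>- 1\<close> for each vector, collected in
  \<open>- 2 * card I\<close>.\<close>

lemma energy_ge_test_vectors:
  fixes q :: "'i \<Rightarrow> nat \<Rightarrow> real"
  assumes I: "finite I"
    and orth: "\<And>i j. i \<in> I \<Longrightarrow> j \<in> I \<Longrightarrow> i \<noteq> j \<Longrightarrow> (\<Sum>v<n. q i v * q j v) = 0"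
  shows "2 * (\<Sum>i\<in>I. ((\<Sum>v<n. q i v)\<^sup>2 - 2 * edge_form n E (q i)) / (\<Sum>v<n. (q i v)\<^sup>2)) - 2 * card I
    \<le> energy (seidel_matrix n E)"
proof -
  define s :: "nat \<Rightarrow> nat \<Rightarrow> real" where
    "s u v = (if u = v then 0 else if E u v then -1 else 1)" for u v
  define N where "N i = (\<Sum>v<n. (q i v)\<^sup>2)" for i
  have row: "(\<Sum>v<n. x v * s u v) = (\<Sum>v<n. x v) - x u - 2 * (\<Sum>v | E u v. x v)"
    if "u < n" for x u
  proof -
    have "(\<Sum>v | E u v. x v) = (\<Sum>v<n. if E u v then x v else 0)"
      by (subst sum.inter_filter[symmetric]) (auto intro!: sum.cong dest: edge_less)
    moreover have "x u = (\<Sum>v<n. if v = u then x v else 0)" using that by simp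
    moreover have "(\<Sum>v<n. x v * s u v) =
        (\<Sum>v<n. x v - (if v = u then x v else 0) - 2 * (if E u v then x v else 0))"
      by (intro sum.cong refl) (auto simp: s_def)
    ultimately show ?thesis by (simp add: sum_subtractf sum_distrib_left)
  qed
  have form: "(\<Sum>u<n. \<Sum>v<n. x u * x v * s u v) = (\<Sum>v<n. x v)\<^sup>2 - (\<Sum>v<n. (x v)\<^sup>2) - 2 * edge_form n E x" for x
  proof -
    have "(\<Sum>u<n. \<Sum>v<n. x u * x v * s u v) = (\<Sum>u<n. x u * (\<Sum>v<n. x v * s u v))"
      by (simp add: sum_distrib_left mult.assoc)
    also have "\<dots> = (\<Sum>u<n. x u * (\<Sum>v<n. x v) - (x u)\<^sup>2 - 2 * (x u * (\<Sum>v | E u v. x v)))"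
      by (intro sum.cong refl) (simp add: row algebra_simps power2_eq_square)
    also have "\<dots> = (\<Sum>v<n. x v)\<^sup>2 - (\<Sum>v<n. (x v)\<^sup>2) - 2 * edge_form n E x"
      unfolding edge_form_def
      by (simp add: sum_subtractf sum_distrib_left[symmetric] sum_distrib_right[symmetric] power2_eq_square)
    finally show ?thesis .
  qed
  \<comment> \<open>Only an inequality: a zero vector gives \<open>- 1\<close> on the left and 0 on
    the right.\<close>
  have "(\<Sum>i\<in>I. ((\<Sum>v<n. q i v)\<^sup>2 - 2 * edge_form n E (q i)) / N i - 1) \<le>
      (\<Sum>i\<in>I. (\<Sum>u<n. \<Sum>v<n. q i u * q i v * s u v) / N i)"
    by (intro sum_mono) (auto simp: form N_def[symmetric] diff_divide_distrib)
  moreover have "2 * (\<Sum>i\<in>I. (\<Sum>u<n. \<Sum>v<n. q i u * q i v * s u v) / N i) \<le> energy (seidel_matrix n E)"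
    unfolding seidel_matrix_eq N_def s_def[symmetric]
    by (intro sum_rayleigh_quotients_le_energy I orth) (auto simp: s_def dest: edge_sym)
  ultimately show ?thesis unfolding N_def by (simp add: sum_subtractf)
qed

lemma edge_form_support:
  assumes F: "F \<subseteq> {..<n}" and out: "\<And>v. v \<notin> F \<Longrightarrow> x v = 0"
  shows "edge_form n E x = (\<Sum>u\<in>F. \<Sum>v\<in>F. if E u v then x u * x v else 0)"
proof -
  have fin: "finite F" using F finite_subset by blast
  have "(\<Sum>v | E u v. x v) = (\<Sum>v\<in>F. if E u v then x v else 0)" for u
  proof -
    have "(\<Sum>v | E u v. x v) = (\<Sum>v\<in>{v \<in> F. E u v}. x v)"
      by (rule sum.mono_neutral_right) (use out in auto)
    then show ?thesis using fin by (simp add: sum.inter_filter)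
  qed
  then have "edge_form n E x = (\<Sum>u<n. x u * (\<Sum>v\<in>F. if E u v then x v else 0))"
    by (simp add: edge_form_def)
  also have "\<dots> = (\<Sum>u\<in>F. x u * (\<Sum>v\<in>F. if E u v then x v else 0))"
    by (rule sum.mono_neutral_right) (use F out in auto)
  finally show ?thesis by (simp add: sum_distrib_left if_distrib cong: if_cong)
qed

subsection \<open>The bound 2n - 2\<close>

text \<open>Switching at the centre removes all edges of the star and leaves \<open>J - I\<close>,
  with top eigenvalue \<open>n - 1\<close>. The test vector is the all-ones vector carried back
  through the switching.\<close>

lemma energy_star:
  assumes c: "c < n" and all: "\<And>v. v < n \<Longrightarrow> v \<noteq> c \<Longrightarrow> E c v"
  shows "energy (seidel_matrix n E) \<ge> 2 * real n - 2"
proof -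
  define q :: "unit \<Rightarrow> nat \<Rightarrow> real" where "q i v = (if v = c then -1 else 1)" for i v
  have nc: "{v. E c v} = {..<n} - {c}" using all edge_less by auto
  have nv: "{v. E u v} = {c}" if "u < n" "u \<noteq> c" for u
  proof -
    have "v = c" if "E u v" for v
      using all[of u] all[of v] that \<open>u < n\<close> \<open>u \<noteq> c\<close> edge_less(2)[OF that] no_triangle[of c u v] edge_sym
      by blast
    then show ?thesis using all that edge_sym by blast
  qed
  have card: "real (card ({..<n} - {c})) = real n - 1" using c by (simp add: card_Diff_singleton of_nat_diff)
  have split: "(\<Sum>v<n. f v) = f c + (\<Sum>v\<in>{..<n} - {c}. f v)" for f :: "nat \<Rightarrow> real"
    using c by (simp add: sum.remove)
  have s1: "(\<Sum>v<n. q () v) = real n - 2" unfolding split using card by (simp add: q_def)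
  have s2: "(\<Sum>v<n. (q () v)\<^sup>2) = real n"
  proof -
    have "(q () v)\<^sup>2 = 1" for v by (simp add: q_def)
    then show ?thesis by simp
  qed
  have "edge_form n E (q ()) = q () c * (\<Sum>v\<in>{..<n} - {c}. q () v) + (\<Sum>u\<in>{..<n} - {c}. q () u * q () c)"
    unfolding edge_form_def split nc
    by (intro arg_cong2[where f = "(+)"] refl sum.cong) (use nv in auto)
  then have s3: "edge_form n E (q ()) = - 2 * (real n - 1)" using card by (simp add: q_def)
  have n: "real n > 0" using c by simp
  have "2 * ((real n - 2)\<^sup>2 - 2 * (- 2 * (real n - 1))) / real n - 2 \<le> energy (seidel_matrix n E)"
    using energy_ge_test_vectors[of "{()}" q] by (simp add: s1 s2 s3)
  also have "(real n - 2)\<^sup>2 - 2 * (- 2 * (real n - 1)) = real n * real n"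
    by (simp add: power2_eq_square algebra_simps)
  finally show ?thesis using n by simp
qed

text \<open>Colour classes are independent, so their indicators have Rayleigh quotients one less
  than their sizes, together \<open>n - 2\<close>. The missing 1 comes from \<open>w\<close>, with
  signs on the two outer edges of the path such that each edge has opposite signs at its ends. The
  middle vertex \<open>c\<close> gives \<open>x\<close> and \<open>m\<close> one colour and
  \<open>l\<close> and \<open>d\<close> the other, so \<open>w\<close> is orthogonal to both
  indicators. Acyclicity excludes further edges among these four vertices.\<close>

lemma energy_path5:
  assumes edges: "E x l" "E l c" "E c d" "E d m" and ne: "x \<noteq> c" "l \<noteq> d" "c \<noteq> m"
  shows "energy (seidel_matrix n E) \<ge> 2 * real n - 2"
proof -
  obtain col :: "nat \<Rightarrow> bool" where col: "\<And>u v. E u v \<Longrightarrow> col u \<noteq> col v"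
    using colouring_and_orientation by metis
  define F where "F = {x, l, d, m}"
  define w :: "nat \<Rightarrow> real" where
    "w v = (if v = x \<or> v = d then 1 else if v = l \<or> v = m then -1 else 0)" for v
  define q :: "nat \<Rightarrow> nat \<Rightarrow> real" where
    "q i = (if i = 0 then (\<lambda>v. of_bool (col v)) else if i = 1 then (\<lambda>v. of_bool (\<not> col v)) else w)" for i
  have F: "F \<subseteq> {..<n}" using edges edge_less by (auto simp: F_def)
  have non: "\<not> E x d" "\<not> E l d" "\<not> E l m" "\<not> E x m"
  proof -
    show "\<not> E x d" using no_square[of x l c d] edges ne edge_sym by blast
    then have "x \<noteq> m" using edges edge_sym by blast
    show "\<not> E l d" using no_triangle[of l c d] edges edge_sym by blast
    show "\<not> E l m" using no_square[of l c d m] edges ne edge_sym by blast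
    have "x \<noteq> d" using no_triangle[of x l c] edges by blast
    have "l \<noteq> m" using no_triangle[of l c d] edges by blast
    have "x \<noteq> l" "l \<noteq> c" "c \<noteq> d" "d \<noteq> m" using edges by auto
    then show "\<not> E x m"
      using no_pentagon[of x l c d m] edges ne edge_sym \<open>x \<noteq> d\<close> \<open>l \<noteq> m\<close> \<open>x \<noteq> m\<close> by auto
  qed
  have dist: "x \<noteq> l" "x \<noteq> d" "x \<noteq> m" "l \<noteq> m" "d \<noteq> m"
    using edges non edge_sym by auto
  note dist = dist dist[symmetric] ne(2) ne(2)[symmetric]
  have non': "\<not> E d x" "\<not> E d l" "\<not> E m l" "\<not> E m x" using non edge_sym by blast+
  have colF: "col l = (\<not> col x)" "col d = (\<not> col x)" "col m = col x"
    using col edges by metis+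
  have sumF: "(\<Sum>v<n. f v * w v) = f x - f l + f d - f m" for f
  proof -
    have "(\<Sum>v<n. f v * w v) = (\<Sum>v\<in>F. f v * w v)"
      by (rule sum.mono_neutral_right) (use F in \<open>auto simp: w_def F_def\<close>)
    then show ?thesis using dist by (simp add: F_def w_def)
  qed
  have w1: "(\<Sum>v<n. w v) = 0" using sumF[of "\<lambda>_. 1"] by simp
  have w2: "(\<Sum>v<n. (w v)\<^sup>2) = 4"
    using sumF[of w] dist by (simp add: w_def power2_eq_square)
  have w3: "edge_form n E w = - 4"
  proof -
    have "edge_form n E w = (\<Sum>u\<in>F. \<Sum>v\<in>F. if E u v then w u * w v else 0)"
      by (rule edge_form_support[OF F]) (auto simp: F_def w_def)
    also have "\<dots> = - 4"
      using dist non non' edges(1,4) edges(1,4)[THEN edge_sym] by (simp add: F_def w_def)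
    finally show ?thesis .
  qed
  define X where "X = {v. v < n \<and> col v}"
  define Y where "Y = {v. v < n \<and> \<not> col v}"
  have bip: "edge_form n E (\<lambda>v. of_bool (P (col v))) = 0" if "P True \<longleftrightarrow> \<not> P False" for P
    unfolding edge_form_def using that
    by (intro sum.neutral ballI) (auto intro!: sum.neutral dest!: col, (metis (full_types))+)
  have sX: "(\<Sum>v<n. of_bool (col v)) = real (card X)" and sY: "(\<Sum>v<n. of_bool (\<not> col v)) = real (card Y)"
    unfolding X_def Y_def by (simp_all add: of_bool_def sum.If_cases Int_def lessThan_def)
  have XY: "card X + card Y = n"
  proof -
    have "card (X \<union> Y) = card X + card Y" by (rule card_Un_disjoint) (auto simp: X_def Y_def)
    moreover have "X \<union> Y = {..<n}" by (auto simp: X_def Y_def)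
    ultimately show ?thesis by simp
  qed
  have sq: "(of_bool b :: real)\<^sup>2 = of_bool b" for b by simp
  have orth: "(\<Sum>v<n. q i v * q j v) = 0" if "i \<in> {0, 1, 2}" "j \<in> {0, 1, 2}" "i < j" for i j
  proof -
    have "(\<Sum>v<n. of_bool (col v) * of_bool (\<not> col v)) = (0::real)" by (intro sum.neutral) auto
    moreover have "(\<Sum>v<n. of_bool (col v) * w v) = 0" "(\<Sum>v<n. of_bool (\<not> col v) * w v) = 0"
      unfolding sumF by (cases "col x"; simp add: colF)+
    ultimately show ?thesis using that by (auto simp: q_def)
  qed
  have orth': "(\<Sum>v<n. q i v * q j v) = 0" if "i \<in> {0, 1, 2}" "j \<in> {0, 1, 2}" "i \<noteq> j" for i j
    using orth[of i j] orth[of j i] that by (cases "i < j") (simp_all add: mult.commute)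
  have bound: "2 * (\<Sum>i\<in>{0, 1, 2}. ((\<Sum>v<n. q i v)\<^sup>2 - 2 * edge_form n E (q i)) / (\<Sum>v<n. (q i v)\<^sup>2))
      - 2 * card {0, 1, 2 :: nat} \<le> energy (seidel_matrix n E)"
    by (rule energy_ge_test_vectors) (use orth' in auto)
  have total: "(\<Sum>i\<in>{0, 1, 2}. ((\<Sum>v<n. q i v)\<^sup>2 - 2 * edge_form n E (q i)) / (\<Sum>v<n. (q i v)\<^sup>2)) =
      real (card X) + real (card Y) + 2"
  proof -
    have "((\<Sum>v<n. q 0 v)\<^sup>2 - 2 * edge_form n E (q 0)) / (\<Sum>v<n. (q 0 v)\<^sup>2) = real (card X)"
      unfolding q_def if_P[OF refl] sq sX bip[of "\<lambda>b. b", simplified] by (simp add: power2_eq_square)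
    moreover have "((\<Sum>v<n. q 1 v)\<^sup>2 - 2 * edge_form n E (q 1)) / (\<Sum>v<n. (q 1 v)\<^sup>2) = real (card Y)"
    proof -
      have q1: "q 1 = (\<lambda>v. of_bool (\<not> col v))" by (simp add: q_def)
      show ?thesis unfolding q1 sq sY bip[of Not, simplified] by (simp add: power2_eq_square)
    qed
    moreover have "((\<Sum>v<n. q 2 v)\<^sup>2 - 2 * edge_form n E (q 2)) / (\<Sum>v<n. (q 2 v)\<^sup>2) = 2"
    proof -
      have q2: "q 2 = w" by (simp add: q_def)
      show ?thesis unfolding q2 w1 w2 w3 by simp
    qed
    ultimately show ?thesis by simp
  qed
  have "2 * (real (card X) + real (card Y) + 2) - real (2 * card {0, 1, 2 :: nat})
      \<le> energy (seidel_matrix n E)"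
    using bound by (simp only: total)
  then show ?thesis using XY by (simp flip: of_nat_add)
qed

text \<open>Switching at \<open>c1\<close> and \<open>L2\<close> turns the double star into the complete bipartite graph on
  \<open>L1\<close>, \<open>L2\<close> with two isolated vertices. The two test vectors span, up to this switching, the
  orthogonal complement of \<open>(-1, 1 / d1, 1 / d2)\<close> among the vectors that are constant on
  \<open>{c1, c2}\<close>, \<open>L1\<close> and \<open>L2\<close>.\<close>

lemma energy_double_star:
  assumes c: "E c1 c2" and L1: "L1 = {v. E c1 v} - {c2}" "L1 \<noteq> {}"
    and L2: "L2 = {v. E c2 v} - {c1}" "L2 \<noteq> {}"
    and all: "{..<n} = {c1, c2} \<union> L1 \<union> L2"
  shows "energy (seidel_matrix n E) \<ge> 2 * real n - 2"
proof -
  define d1 d2 where "d1 = real (card L1)" and "d2 = real (card L2)"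
  define m where "m = d1 + d2"
  have fin: "finite L1" "finite L2" unfolding L1 L2 by auto
  have ne: "c1 \<noteq> c2" using c by auto
  have notin: "c1 \<notin> L1" "c2 \<notin> L1" "c1 \<notin> L2" "c2 \<notin> L2" unfolding L1 L2 by auto
  have disj: "L1 \<inter> L2 = {}" unfolding L1 L2 using no_triangle[of c1 c2] c edge_sym by blast
  have d: "d1 \<ge> 1" "d2 \<ge> 1"
    unfolding d1_def d2_def using L1(2) L2(2) fin by (auto simp: Suc_le_eq card_gt_0_iff)
  have split: "(\<Sum>v<n. f v) = f c1 + f c2 + (\<Sum>v\<in>L1. f v) + (\<Sum>v\<in>L2. f v)" for f :: "nat \<Rightarrow> real"
    unfolding all using fin ne notin disj by (subst sum.union_disjoint; auto)+
  have "n = card {..<n}" by simp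
  also have "real \<dots> = 2 + m"
    using split[of "\<lambda>_. 1"] by (simp add: m_def d1_def d2_def)
  finally have n: "real n = 2 + m" .
  have nb1: "{v. E c1 v} = insert c2 L1" and nb2: "{v. E c2 v} = insert c1 L2"
    unfolding L1 L2 using c edge_sym by auto
  have nbL1: "{v. E u v} = {c1}" if u: "u \<in> L1" for u
  proof -
    have uc: "E c1 u" "u \<noteq> c2" using u by (auto simp: L1)
    have "v = c1" if "E u v" for v
    proof (rule ccontr)
      assume v: "v \<noteq> c1"
      have "v \<in> {c1, c2} \<union> L1 \<union> L2" using all edge_less(2)[OF that] by blast
      then consider "E c1 v" | "E c2 v" using v c by (auto simp: L1 L2)
      then show False
        using no_triangle[of c1 u v] no_square[of c1 u v c2] uc v that c edge_sym by cases metis+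
    qed
    then show ?thesis using uc edge_sym by blast
  qed
  have nbL2: "{v. E u v} = {c2}" if u: "u \<in> L2" for u
  proof -
    have uc: "E c2 u" "u \<noteq> c1" using u by (auto simp: L2)
    have "v = c2" if "E u v" for v
    proof (rule ccontr)
      assume v: "v \<noteq> c2"
      have "v \<in> {c1, c2} \<union> L1 \<union> L2" using all edge_less(2)[OF that] by blast
      then consider "E c1 v" | "E c2 v" using v c edge_sym by (auto simp: L1 L2)
      then show False
        using no_triangle[of c2 u v] no_square[of c2 u v c1] uc v that c edge_sym by cases metis+
    qed
    then show ?thesis using uc edge_sym by blast
  qed
  have form: "edge_form n E x =
      x c1 * (x c2 + sum x L1) + x c2 * (x c1 + sum x L2) + sum x L1 * x c1 + sum x L2 * x c2" for x
    unfolding edge_form_def split nb1 nb2 using fin notin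
    by (simp add: nbL1 nbL2 sum_distrib_right)
  define q :: "bool \<Rightarrow> nat \<Rightarrow> real" where
    "q b v = (if b then if v = c1 \<or> v = c2 then 0 else 1
      else if v = c1 then - m / 2 else if v = c2 then m / 2 else if v \<in> L1 then d2 else - d1)" for b v
  have vals: "q True c1 = 0" "q True c2 = 0" "v \<in> L1 \<union> L2 \<Longrightarrow> q True v = 1"
    "q False c1 = - m / 2" "q False c2 = m / 2" "v \<in> L1 \<Longrightarrow> q False v = d2" "v \<in> L2 \<Longrightarrow> q False v = - d1" for v
    using ne notin disj by (auto simp: q_def)
  have sums: "sum (q True) L1 = d1" "sum (q True) L2 = d2" "sum (q False) L1 = d1 * d2" "sum (q False) L2 = - (d1 * d2)"
    by (simp_all add: vals d1_def d2_def)
  have sq: "(\<Sum>v<n. (q True v)\<^sup>2) = m" "(\<Sum>v<n. (q False v)\<^sup>2) = m * (m / 2 + d1 * d2)"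
    unfolding split by (simp_all add: vals d1_def[symmetric] d2_def[symmetric] m_def power2_eq_square algebra_simps)
  have tot: "(\<Sum>v<n. q True v) = m" "(\<Sum>v<n. q False v) = 0"
    unfolding split sums by (simp_all add: vals, simp add: m_def)
  have ef: "edge_form n E (q True) = 0" "edge_form n E (q False) = - (m * (m / 2 + 2 * (d1 * d2)))"
    unfolding form sums by (simp_all add: vals algebra_simps)
  have orth: "(\<Sum>v<n. q True v * q False v) = 0"
    unfolding split by (simp add: vals d1_def[symmetric] d2_def[symmetric])
  have "2 * (\<Sum>b\<in>UNIV. ((\<Sum>v<n. q b v)\<^sup>2 - 2 * edge_form n E (q b)) / (\<Sum>v<n. (q b v)\<^sup>2))
      - 2 * card (UNIV :: bool set) \<le> energy (seidel_matrix n E)"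
  proof (rule energy_ge_test_vectors)
    show "(\<Sum>v<n. q b v * q b' v) = 0" if "b \<noteq> b'" for b b'
      using that orth by (cases b) (simp_all add: mult.commute)
  qed simp
  then have E1: "2 * (m\<^sup>2 / m + (2 * (m * (m / 2 + 2 * (d1 * d2)))) / (m * (m / 2 + d1 * d2))) - 4
      \<le> energy (seidel_matrix n E)"
    by (simp add: UNIV_bool tot ef sq add.commute)
  have m: "m > 0" using d by (simp add: m_def)
  \<comment> \<open>Exactly what the second quotient needs:
    \<open>2 * (m / 2 + 2 * t) / (m / 2 + t) \<ge> 3\<close> is equivalent to
    \<open>t \<ge> m / 2\<close>.\<close>
  have t: "d1 * d2 \<ge> m / 2"
  proof -
    have "1 * d2 \<le> d1 * d2" "d1 * 1 \<le> d1 * d2" using d by (intro mult_mono; simp)+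
    then show ?thesis by (simp add: m_def)
  qed
  have pos: "m / 2 + d1 * d2 > 0" using m t by linarith
  have "(2 * (m * (m / 2 + 2 * (d1 * d2)))) / (m * (m / 2 + d1 * d2))
      = 2 * (m / 2 + 2 * (d1 * d2)) / (m / 2 + d1 * d2)"
    using m by simp
  also have "\<dots> \<ge> 3" using pos t by (simp add: le_divide_eq)
  finally obtain R where R: "R \<ge> 3" "R = (2 * (m * (m / 2 + 2 * (d1 * d2)))) / (m * (m / 2 + d1 * d2))"
    by blast
  have "m\<^sup>2 / m = m" using m by (simp add: power2_eq_square)
  then have "2 * (m + R) - 4 \<le> energy (seidel_matrix n E)" using E1 unfolding R(2) by simp
  moreover have "2 * real n - 2 \<le> 2 * (m + R) - 4" using R(1) unfolding n by simp
  ultimately show ?thesis by simp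
qed

text \<open>A tree that is neither a star nor a double star contains an induced path on five vertices.\<close>

lemma energy_ge:
  "energy (seidel_matrix n E) \<ge> 2 * real n - 2"
proof (cases "n \<ge> 2")
  case False
  then have "n = 1" using tree by (simp add: is_tree_def)
  moreover have "energy (seidel_matrix n E) \<ge> 0" unfolding energy_def by (simp add: sum_nonneg)
  ultimately show ?thesis by simp
next
  case n2: True
  show ?thesis
  proof (cases "\<exists>c<n. \<forall>v<n. v \<noteq> c \<longrightarrow> E c v")
    case True
    then show ?thesis using energy_star by blast
  next
    case False
    have "\<exists>c1 c2 l m. E c1 c2 \<and> E c1 l \<and> l \<noteq> c2 \<and> E c2 m \<and> m \<noteq> c1"
    proof (rule ccontr)
      assume no: "\<not> ?thesis"
      obtain y where y: "E 0 y" using ex_neighbour[of 0] n2 by auto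
      \<comment> \<open>Every edge now has an end of degree one, so the edge between 0 and
        \<open>y\<close> determines the centre: \<open>y\<close> if 0 has no other neighbour, else
        0.\<close>
      obtain c where c: "c < n" "\<And>u v. E c u \<Longrightarrow> E u v \<Longrightarrow> v = c"
      proof (cases "\<forall>v. E 0 v \<longrightarrow> v = y")
        case True
        then have "\<And>u v. E y u \<Longrightarrow> E u v \<Longrightarrow> v = y"
          using no y edge_sym by metis
        then show thesis using that y edge_less by blast
      next
        case False
        then have "\<And>u v. E 0 u \<Longrightarrow> E u v \<Longrightarrow> v = 0"
          using no y edge_sym by metis
        then show thesis using that y edge_less by blast
      qed
      have "{..<n} \<subseteq> insert c {v. E c v}"
        by (rule closed_set_all[OF c(1)]) (use c(2) in auto)
      then show False using False c(1) by blast
    qed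
    then obtain c1 c2 l m where c: "E c1 c2" "E c1 l" "l \<noteq> c2" "E c2 m" "m \<noteq> c1" by blast
    define L1 where "L1 = {v. E c1 v} - {c2}"
    define L2 where "L2 = {v. E c2 v} - {c1}"
    show ?thesis
    proof (cases "{..<n} \<subseteq> {c1, c2} \<union> L1 \<union> L2")
      case True
      then have "{..<n} = {c1, c2} \<union> L1 \<union> L2"
        using c edge_less by (auto simp: L1_def L2_def)
      then show ?thesis using energy_double_star[OF c(1) L1_def _ L2_def] c by (auto simp: L1_def L2_def)
    next
      case False
      \<comment> \<open>An edge leaving the double star must start at one of its leaves, which
        extends the path through both centres to five vertices.\<close>
      obtain u x where ux: "u \<in> {c1, c2} \<union> L1 \<union> L2" "E u x" "x \<notin> {c1, c2} \<union> L1 \<union> L2"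
        using closed_set_all[of c1 "{c1, c2} \<union> L1 \<union> L2"] False c(1) edge_less by blast
      then consider "u \<in> L1" | "u \<in> L2" using c by (auto simp: L1_def L2_def)
      then show ?thesis
      proof cases
        case 1
        then show ?thesis
          using energy_path5[of x u c1 c2 m] ux c edge_sym by (auto simp: L1_def L2_def)
      next
        case 2
        then show ?thesis
          using energy_path5[of x u c2 c1 l] ux c edge_sym by (auto simp: L1_def L2_def)
      qed
    qed
  qed
qed

subsection \<open>Partitions into stars\<close>

text \<open>Edges between the other vertices need not be excluded, since the tree has no triangles.
  A singleton is a star, and both vertices of a two-vertex star are centres.\<close>

definition star_centre :: "nat set \<Rightarrow> nat \<Rightarrow> bool" where
  "star_centre B c \<longleftrightarrow> c \<in> B \<and> (\<forall>x\<in>B - {c}. E c x)"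

definition star_partition :: "nat set set \<Rightarrow> bool" where
  "star_partition P \<longleftrightarrow> partition_on {..<n} P \<and> (\<forall>B\<in>P. \<exists>c. star_centre B c)"

lemma star_edge_iff:
  assumes "star_centre B c" "u \<in> B" "v \<in> B"
  shows "E u v \<longleftrightarrow> u \<noteq> v \<and> (u = c \<or> v = c)"
proof (cases "u = c \<or> v = c")
  case True
  then show ?thesis using assms edge_sym by (auto simp: star_centre_def)
next
  case False
  then have "E c u" "E c v" using assms by (auto simp: star_centre_def)
  then show ?thesis using False no_triangle[of c u v] edge_sym by blast
qed

lemma star_form:
  fixes x :: "nat \<Rightarrow> real"
  assumes B: "finite B" "star_centre B c" and x: "\<And>v. v \<in> B - {c} \<Longrightarrow> x v = b"
  shows "(\<Sum>u\<in>B. \<Sum>v\<in>B. if E u v then x u * x v else 0) = 2 * real (card B - 1) * x c * b"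
proof -
  have c: "c \<in> B" using B by (simp add: star_centre_def)
  have cl: "card (B - {c}) = card B - 1" using c B by simp
  have row_c: "(\<Sum>v\<in>B. if E c v then x c * x v else 0) = real (card B - 1) * (x c * b)"
  proof -
    have "(\<Sum>v\<in>B. if E c v then x c * x v else 0) = (\<Sum>v\<in>B - {c}. x c * b)"
      unfolding sum.remove[OF B(1) c] using star_edge_iff[OF B(2) c] x by simp
    then show ?thesis by (simp add: cl)
  qed
  have row: "(\<Sum>v\<in>B. if E u v then x u * x v else 0) = x c * b" if u: "u \<in> B - {c}" for u
  proof -
    have "(\<Sum>v\<in>B. if E u v then x u * x v else 0) = (\<Sum>v\<in>B. if v = c then x u * x v else 0)"
      using star_edge_iff[OF B(2)] u by (intro sum.cong refl) auto
    then show ?thesis using B(1) c x[OF u] by simp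
  qed
  show ?thesis
    unfolding sum.remove[OF B(1) c, of "\<lambda>u. \<Sum>v\<in>B. if E u v then x u * x v else 0"] row_c
    using row by (simp add: cl)
qed

text \<open>The test space is spanned by the bottom eigenvectors \<open>y\<close> of the stars and the component \<open>z\<close>
  of the all-ones vector orthogonal to them. On each star \<open>z\<close> is a multiple of the top
  eigenvector, so its Rayleigh quotient is at most the largest star eigenvalue plus the
  contribution of the edges between stars; as a star has at most one edge pointing to a parent outside,
  that contribution is at most 1.\<close>

lemma energy_ge_star_partition:
  assumes P: "star_partition P" and big: "\<And>B. B \<in> P \<Longrightarrow> card B \<ge> 2"
    and B1: "B1 \<in> P" and max: "\<And>B. B \<in> P \<Longrightarrow> card B \<le> card B1"
  shows "energy (seidel_matrix n E) \<ge>
    2 * real n - 8 + 2 * (\<Sum>B\<in>P - {B1}. 2 * sqrt (real (card B - 1)) - 1)"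
proof -
  have part: "partition_on {..<n} P" using P by (simp add: star_partition_def)
  have finP: "finite P" using part by (rule finite_elements[rotated]) simp
  have sub: "B \<subseteq> {..<n}" if "B \<in> P" for B using part that by (auto simp: partition_on_def)
  have finB: "finite B" if "B \<in> P" for B using sub[OF that] finite_subset by blast
  have disj: "B = C" if "B \<in> P" "C \<in> P" "v \<in> B" "v \<in> C" for B C v
    using part that by (auto simp: partition_on_def disjoint_def)
  have sumP: "(\<Sum>v<n. f v) = (\<Sum>B\<in>P. \<Sum>v\<in>B. f v)" for f :: "nat \<Rightarrow> real"
  proof -
    have "(\<Sum>v\<in>\<Union>P. f v) = (\<Sum>B\<in>P. \<Sum>v\<in>B. f v)"
      using sum.Union_disjoint[of P f] finB disj by (auto simp: o_def)
    then show ?thesis using part by (simp add: partition_on_def)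
  qed
  define cen where "cen B = (SOME c. star_centre B c)" for B
  have cen: "star_centre B (cen B)" if "B \<in> P" for B
    unfolding cen_def using P that by (auto simp: star_partition_def intro: someI_ex)
  have cenB: "cen B \<in> B" if "B \<in> P" for B using cen[OF that] by (simp add: star_centre_def)
  define blk where "blk v = (THE B. B \<in> P \<and> v \<in> B)" for v
  have blk: "blk v = B" if "B \<in> P" "v \<in> B" for B v
    unfolding blk_def by (rule the_equality) (use that disj in auto)
  have blkP: "blk v \<in> P" "v \<in> blk v" if "v < n" for v
  proof -
    have "v \<in> \<Union>P" using part that by (simp add: partition_on_def)
    then obtain B where "B \<in> P" "v \<in> B" by blast
    then show "blk v \<in> P" "v \<in> blk v" using blk by auto
  qed
  define r where "r B = sqrt (real (card B - 1))" for B :: "nat set"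
  have leaves: "real (card (B - {cen B})) = (r B)\<^sup>2" if "B \<in> P" for B
    using finB[OF that] cenB[OF that] by (simp add: r_def)
  have r1: "r B \<ge> 1" if "B \<in> P" for B using big[OF that] by (simp add: r_def)
  have rsq: "real (card B - 1) = (r B)\<^sup>2" for B by (simp add: r_def)
  have rmax: "r B \<le> r B1" if "B \<in> P" for B using max[OF that] by (simp add: r_def)
  have cardB: "real (card B) = (r B)\<^sup>2 + 1" if "B \<in> P" for B
    using big[OF that] by (simp add: rsq[symmetric] of_nat_diff)
  have sumB: "(\<Sum>v\<in>B. f v) = f (cen B) + (r B)\<^sup>2 * b"
    if "B \<in> P" "\<And>v. v \<in> B - {cen B} \<Longrightarrow> f v = b" for B and f :: "nat \<Rightarrow> real" and b
    using that leaves[OF that(1)] sum.remove[OF finB[OF that(1)] cenB[OF that(1)], of f] by simp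

  define y where "y B v = (if v \<notin> B then 0 else if v = cen B then r B else -1)" for B v
  \<comment> \<open>The projection of the all-ones vector of a star with \<open>r\<^sup>2\<close>
    leaves onto \<open>y\<close> has coefficient \<open>(1 - r) / (2 * r)\<close>; subtracting it
    gives these values.\<close>
  define z where "z v = (if v = cen (blk v) then (1 + r (blk v)) / 2 else (1 + 1 / r (blk v)) / 2)" for v
  have zc: "z (cen B) = (1 + r B) / 2" if "B \<in> P" for B
    using blk[OF that cenB[OF that]] by (simp add: z_def)
  have zl: "z v = (1 + 1 / r B) / 2" if "B \<in> P" "v \<in> B - {cen B}" for B v
    using blk[of B v] that by (simp add: z_def)
  \<comment> \<open>Both the sum and the squared norm of \<open>z\<close> on \<open>B\<close>; they
    agree because \<open>z\<close> is a projection of the all-ones vector.\<close>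
  define w where "w B = (1 + r B)\<^sup>2 / 2" for B
  have wpos: "w B > 0" if "B \<in> P" for B using r1[OF that] by (simp add: w_def)
  have z1: "(\<Sum>v\<in>B. z v) = w B" and z2: "(\<Sum>v\<in>B. (z v)\<^sup>2) = w B"
    and zy: "(\<Sum>v\<in>B. z v * y B v) = 0" if B: "B \<in> P" for B
  proof -
    have r: "(r B)\<^sup>2 * ((1 + 1 / r B) / 2) = ((r B)\<^sup>2 + r B) / 2"
      "(r B)\<^sup>2 * ((1 + 1 / r B) / 2)\<^sup>2 = (1 + r B)\<^sup>2 / 4"
      using r1[OF B] by (simp_all add: field_simps power2_eq_square)
    have "(\<Sum>v\<in>B. z v) = z (cen B) + (r B)\<^sup>2 * ((1 + 1 / r B) / 2)"
      by (rule sumB[OF B]) (rule zl[OF B])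
    then show "(\<Sum>v\<in>B. z v) = w B"
      unfolding r zc[OF B] by (simp add: w_def power2_eq_square field_simps)
    have "(\<Sum>v\<in>B. (z v)\<^sup>2) = (z (cen B))\<^sup>2 + (r B)\<^sup>2 * ((1 + 1 / r B) / 2)\<^sup>2"
      by (rule sumB[OF B]) (simp only: zl[OF B])
    then show "(\<Sum>v\<in>B. (z v)\<^sup>2) = w B"
      unfolding r zc[OF B] by (simp add: w_def power_divide)
    have "(\<Sum>v\<in>B. z v * y B v) = z (cen B) * y B (cen B) + (r B)\<^sup>2 * (- ((1 + 1 / r B) / 2))"
    proof (rule sumB[OF B])
      fix v assume v: "v \<in> B - {cen B}"
      then show "z v * y B v = - ((1 + 1 / r B) / 2)" unfolding zl[OF B v] by (simp add: y_def)
    qed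
    then show "(\<Sum>v\<in>B. z v * y B v) = 0"
      unfolding mult_minus_right r zc[OF B] using cenB[OF B]
      by (simp add: y_def power2_eq_square field_simps)
  qed
  have y1: "(\<Sum>v<n. y B v) = r B - (r B)\<^sup>2" and y2: "(\<Sum>v<n. (y B v)\<^sup>2) = 2 * (r B)\<^sup>2"
    and zyn: "(\<Sum>v<n. z v * y B v) = 0" if B: "B \<in> P" for B
  proof -
    have red: "(\<Sum>v<n. f v) = (\<Sum>v\<in>B. f v)" if "\<And>v. v \<notin> B \<Longrightarrow> f v = 0" for f :: "nat \<Rightarrow> real"
      by (rule sum.mono_neutral_right) (use sub[OF B] that in auto)
    show "(\<Sum>v<n. y B v) = r B - (r B)\<^sup>2"
      using sumB[OF B, of "y B" "-1"] cenB[OF B] red[of "y B"] by (simp add: y_def)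
    show "(\<Sum>v<n. (y B v)\<^sup>2) = 2 * (r B)\<^sup>2"
      using sumB[OF B, of "\<lambda>v. (y B v)\<^sup>2" 1] cenB[OF B] red[of "\<lambda>v. (y B v)\<^sup>2"] by (simp add: y_def)
    show "(\<Sum>v<n. z v * y B v) = 0"
      using zy[OF B] red[of "\<lambda>v. z v * y B v"] by (simp add: y_def)
  qed
  have yform: "edge_form n E (y B) = - 2 * (r B) ^ 3" if B: "B \<in> P" for B
  proof -
    have "edge_form n E (y B) = (\<Sum>u\<in>B. \<Sum>v\<in>B. if E u v then y B u * y B v else 0)"
      by (rule edge_form_support[OF sub[OF B]]) (simp add: y_def)
    also have "\<dots> = 2 * real (card B - 1) * y B (cen B) * (-1)"
      by (rule star_form[OF finB[OF B] cen[OF B]]) (simp add: y_def)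
    finally show ?thesis unfolding rsq using cenB[OF B]
      by (simp add: y_def power3_eq_cube power2_eq_square)
  qed

  obtain p where p: "\<And>u v. E u v \<Longrightarrow> p u = v \<or> p v = u"
    using colouring_and_orientation by metis
  have zpos: "z v > 0" if "v < n" for v
    using r1[OF blkP(1)[OF that]] by (simp add: z_def add_pos_pos)
  have zle: "z v \<le> (1 + r B) / 2" if "B \<in> P" "v \<in> B" for B v
  proof -
    have "1 / r B \<le> r B" using r1[OF that(1)] by (smt (verit) divide_le_eq_1)
    then show ?thesis using zc[OF that(1)] zl[of B v] that by (cases "v = cen B") auto
  qed
  \<comment> \<open>The child ends of the edges between different stars.\<close>
  define Out where "Out = {u. E u (p u) \<and> p u \<notin> blk u}"
  have Outn: "Out \<subseteq> {..<n}" by (auto simp: Out_def dest: edge_less)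
  then have finO: "finite Out" using finite_subset by blast
  have zz: "0 \<le> z u * z (p u)" if "u \<in> Out" for u
    using that zpos edge_less by (auto simp: Out_def intro!: mult_nonneg_nonneg less_imp_le)
  have inj: "inj_on blk Out"
  proof (rule inj_onI)
    fix u v assume u: "u \<in> Out" and v: "v \<in> Out" and eq: "blk u = blk v"
    define B where "B = blk u"
    have uB: "u \<in> B" and vB: "v \<in> B" and B: "B \<in> P"
      using blkP[of u] blkP[of v] u v Outn eq by (auto simp: B_def)
    have pu: "p u \<notin> B" "p v \<notin> B" using u v eq by (auto simp: Out_def B_def)
    let ?c = "cen B"
    \<comment> \<open>If a leaf \<open>x\<close> of the star has its parent elsewhere, the edge
      joining it to the centre must point from the centre to \<open>x\<close>. As \<open>p\<close>
      is a function, this fixes \<open>x\<close> and also keeps the parent of the centre inside the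
      star.\<close>
    have to_leaf: "p ?c = x" if "x \<in> B" "x \<noteq> ?c" "p x \<notin> B" for x
      using p[of ?c x] cen[OF B] cenB[OF B] that by (auto simp: star_centre_def)
    show "u = v"
      using to_leaf[of u] to_leaf[of v] uB vB pu by metis
  qed
  have form_split: "edge_form n E z \<le>
      (\<Sum>B\<in>P. \<Sum>u\<in>B. \<Sum>v\<in>B. if E u v then z u * z v else 0) + (\<Sum>u\<in>Out. 2 * z u * z (p u))"
  proof -
    let ?X = "{(u, v). E u v \<and> v \<notin> blk u}"
    have row: "(\<Sum>v | E u v. z u * z v) =
        (\<Sum>v\<in>blk u. if E u v then z u * z v else 0) + (\<Sum>v | E u v \<and> v \<notin> blk u. z u * z v)"
      if u: "u < n" for u
    proof -
      have "{v. E u v} = {v \<in> blk u. E u v} \<union> {v. E u v \<and> v \<notin> blk u}" by auto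
      then have "(\<Sum>v | E u v. z u * z v) =
          (\<Sum>v\<in>{v \<in> blk u. E u v}. z u * z v) + (\<Sum>v | E u v \<and> v \<notin> blk u. z u * z v)"
        using sum.union_disjoint[of "{v \<in> blk u. E u v}" "{v. E u v \<and> v \<notin> blk u}"]
          finB[OF blkP(1)[OF u]] finite_subset[OF _ finite_nbrs[of u]] by auto
      then show ?thesis using finB[OF blkP(1)[OF u]] by (simp add: sum.inter_filter)
    qed
    have "edge_form n E z = (\<Sum>u<n. \<Sum>v\<in>blk u. if E u v then z u * z v else 0)
        + (\<Sum>u<n. \<Sum>v | E u v \<and> v \<notin> blk u. z u * z v)"
      unfolding edge_form_def sum_distrib_left sum.distrib[symmetric]
      by (intro sum.cong refl) (use row in auto)
    also have "(\<Sum>u<n. \<Sum>v\<in>blk u. if E u v then z u * z v else 0) =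
        (\<Sum>B\<in>P. \<Sum>u\<in>B. \<Sum>v\<in>B. if E u v then z u * z v else 0)"
      unfolding sumP by (intro sum.cong refl) (use blk in auto)
    also have "(\<Sum>u<n. \<Sum>v | E u v \<and> v \<notin> blk u. z u * z v) = (\<Sum>(u, v)\<in>?X. z u * z v)"
    proof -
      have "?X = (SIGMA u:{..<n}. {v. E u v \<and> v \<notin> blk u})" by (auto dest: edge_less)
      then show ?thesis by (simp add: sum.Sigma finite_subset[OF _ finite_nbrs])
    qed
    also have "(\<Sum>(u, v)\<in>?X. z u * z v) \<le>
        (\<Sum>(u, v)\<in>(\<lambda>u. (u, p u)) ` Out \<union> (\<lambda>u. (p u, u)) ` Out. z u * z v)"
    proof (rule sum_mono2)
      show "?X \<subseteq> (\<lambda>u. (u, p u)) ` Out \<union> (\<lambda>u. (p u, u)) ` Out"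
      proof (clarsimp)
        fix u v assume uv: "E u v" "v \<notin> blk u" "(u, v) \<notin> (\<lambda>u. (p u, u)) ` Out"
        have "u \<notin> blk v" using blk[OF blkP(1), of v u] blkP(2)[of v] edge_less[OF uv(1)] uv(2) by auto
        then have "p v \<noteq> u" using uv edge_sym[OF uv(1)] by (auto simp: Out_def)
        then show "(u, v) \<in> (\<lambda>u. (u, p u)) ` Out" using p[OF uv(1)] uv by (auto simp: Out_def)
      qed
    next
      fix e assume "e \<in> (\<lambda>u. (u, p u)) ` Out \<union> (\<lambda>u. (p u, u)) ` Out - ?X"
      then obtain u where "u \<in> Out" "e = (u, p u) \<or> e = (p u, u)" by auto
      then show "0 \<le> (case e of (u, v) \<Rightarrow> z u * z v)"
        using zz by (auto simp: mult.commute)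
    qed (use finO in auto)
    also have "\<dots> \<le> (\<Sum>(u, v)\<in>(\<lambda>u. (u, p u)) ` Out. z u * z v) + (\<Sum>(u, v)\<in>(\<lambda>u. (p u, u)) ` Out. z u * z v)"
    proof -
      have "(\<Sum>(u, v)\<in>(\<lambda>u. (u, p u)) ` Out \<inter> (\<lambda>u. (p u, u)) ` Out. z u * z v) \<ge> 0"
        by (rule sum_nonneg) (use zz in \<open>auto simp: mult.commute\<close>)
      then show ?thesis using finO by (simp add: sum_Un)
    qed
    also have "\<dots> = (\<Sum>u\<in>Out. 2 * z u * z (p u))"
    proof -
      have "inj_on (\<lambda>u. (u, p u)) Out" "inj_on (\<lambda>u. (p u, u)) Out" by (auto simp: inj_on_def)
      then show ?thesis
        by (simp add: sum.reindex o_def sum.distrib[symmetric]) (simp add: mult_ac)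
    qed
    finally show ?thesis by simp
  qed
  define M where "M = r B1"
  \<comment> \<open>Twice the product of \<open>(1 + r B) / 2\<close> and
    \<open>(1 + M) / 2\<close>, the largest values of \<open>z\<close> on \<open>B\<close> and on
    any star: the cost of one outgoing edge, counted in both directions.\<close>
  define out where "out B = (1 + M) * (1 + r B) / 2" for B
  have cross: "(\<Sum>u\<in>Out. 2 * z u * z (p u)) \<le> (\<Sum>B\<in>P. out B)"
  proof -
    have "(\<Sum>u\<in>Out. 2 * z u * z (p u)) \<le> (\<Sum>u\<in>Out. out (blk u))"
    proof (rule sum_mono)
      fix u assume u: "u \<in> Out"
      then have n: "u < n" "p u < n" by (auto simp: Out_def dest: edge_less)
      have "z (p u) \<le> (1 + M) / 2"
        using zle[OF blkP[OF n(2)]] rmax[OF blkP(1)[OF n(2)]] by (simp add: M_def)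
      then have "z u * z (p u) \<le> (1 + r (blk u)) / 2 * ((1 + M) / 2)"
        using zle[OF blkP[OF n(1)]] zpos[OF n(1)] zpos[OF n(2)] by (intro mult_mono) auto
      then show "2 * z u * z (p u) \<le> out (blk u)" by (simp add: out_def algebra_simps)
    qed
    also have "\<dots> = (\<Sum>B\<in>blk ` Out. out B)" using inj by (simp add: sum.reindex)
    also have "\<dots> \<le> (\<Sum>B\<in>P. out B)"
    proof (rule sum_mono2[OF finP])
      show "blk ` Out \<subseteq> P" using blkP Outn by auto
      show "0 \<le> out B" if "B \<in> P - blk ` Out" for B
        using that r1[of B] r1[OF B1] by (simp add: out_def M_def)
    qed
    finally show ?thesis .
  qed
  define W where "W = (\<Sum>B\<in>P. w B)"
  have W0: "W > 0" unfolding W_def using finP B1 wpos by (intro sum_pos) auto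
  have zform: "edge_form n E z \<le> (M + 1) * W"
  proof -
    have "(\<Sum>B\<in>P. \<Sum>u\<in>B. \<Sum>v\<in>B. if E u v then z u * z v else 0) = (\<Sum>B\<in>P. r B * w B)"
    proof (rule sum.cong[OF refl])
      fix B assume B: "B \<in> P"
      have "(\<Sum>u\<in>B. \<Sum>v\<in>B. if E u v then z u * z v else 0) =
          2 * real (card B - 1) * z (cen B) * ((1 + 1 / r B) / 2)"
        by (rule star_form[OF finB[OF B] cen[OF B] zl[OF B]])
      also have "\<dots> = r B * w B"
        unfolding rsq zc[OF B] using r1[OF B] by (simp add: w_def field_simps power2_eq_square)
      finally show "(\<Sum>u\<in>B. \<Sum>v\<in>B. if E u v then z u * z v else 0) = r B * w B" .
    qed
    then have "edge_form n E z \<le> (\<Sum>B\<in>P. r B * w B + out B)"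
      using form_split cross by (simp add: sum.distrib)
    also have "\<dots> \<le> (\<Sum>B\<in>P. (M + 1) * w B)"
    proof (rule sum_mono)
      fix B assume B: "B \<in> P"
      \<comment> \<open>This product is exactly the difference of the two sides of the
        claim.\<close>
      have "0 \<le> r B * (1 + r B) * (M - r B) / 2"
        using r1[OF B] rmax[OF B] by (simp add: M_def)
      then show "r B * w B + out B \<le> (M + 1) * w B"
        by (simp add: out_def w_def power2_eq_square field_simps)
    qed
    finally show ?thesis by (simp add: W_def sum_distrib_left)
  qed

  define q where "q i = (case i of None \<Rightarrow> z | Some B \<Rightarrow> y B)" for i
  let ?I = "insert None (Some ` P)"
  have yy: "(\<Sum>v<n. y B v * y C v) = 0" if "B \<in> P" "C \<in> P" "B \<noteq> C" for B C
  proof (rule sum.neutral, rule ballI)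
    fix v
    show "y B v * y C v = 0" using disj[OF that(1,2)] that(3) by (auto simp: y_def)
  qed
  have "2 * (\<Sum>i\<in>?I. ((\<Sum>v<n. q i v)\<^sup>2 - 2 * edge_form n E (q i)) / (\<Sum>v<n. (q i v)\<^sup>2)) - 2 * card ?I
      \<le> energy (seidel_matrix n E)"
  proof (rule energy_ge_test_vectors)
    fix i j assume "i \<in> ?I" "j \<in> ?I" "i \<noteq> j"
    then show "(\<Sum>v<n. q i v * q j v) = 0"
      using yy zyn zyn[unfolded mult.commute[of "z _"]] by (cases i; cases j) (simp_all add: q_def image_iff)
  qed (use finP in simp)
  then have bound: "2 * ((W\<^sup>2 - 2 * edge_form n E z) / W +
      (\<Sum>B\<in>P. ((\<Sum>v<n. y B v)\<^sup>2 - 2 * edge_form n E (y B)) / (\<Sum>v<n. (y B v)\<^sup>2))) - 2 * (real (card P) + 1)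
      \<le> energy (seidel_matrix n E)"
    using finP z1 z2
    by (simp add: q_def sum.reindex card_image sumP[of z] sumP[of "\<lambda>v. (z v)\<^sup>2"] W_def[symmetric] add.commute)
  \<comment> \<open>Each quotient equals \<open>w B\<close>. The form
    \<open>card B - w B + 2 * r B\<close> makes the total \<open>W\<close> cancel against the
    quotient of \<open>z\<close>.\<close>
  have "(\<Sum>B\<in>P. ((\<Sum>v<n. y B v)\<^sup>2 - 2 * edge_form n E (y B)) / (\<Sum>v<n. (y B v)\<^sup>2)) =
      (\<Sum>B\<in>P. real (card B) - w B + 2 * r B)"
  proof (rule sum.cong[OF refl])
    fix B assume B: "B \<in> P"
    show "((\<Sum>v<n. y B v)\<^sup>2 - 2 * edge_form n E (y B)) / (\<Sum>v<n. (y B v)\<^sup>2) = real (card B) - w B + 2 * r B"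
      unfolding y1[OF B] y2[OF B] yform[OF B] cardB[OF B] w_def
      using r1[OF B] by (simp add: field_simps power2_eq_square power3_eq_cube)
  qed
  also have "\<dots> = real n - W + (\<Sum>B\<in>P. 2 * r B)"
    using sumP[of "\<lambda>_. 1"] by (simp add: sum.distrib sum_subtractf W_def)
  finally have ysum: "(\<Sum>B\<in>P. ((\<Sum>v<n. y B v)\<^sup>2 - 2 * edge_form n E (y B)) / (\<Sum>v<n. (y B v)\<^sup>2)) =
      real n - W + (\<Sum>B\<in>P. 2 * r B)" .
  have zq: "(W\<^sup>2 - 2 * edge_form n E z) / W \<ge> W - 2 * (M + 1)"
    using zform W0 by (simp add: le_divide_eq power2_eq_square algebra_simps)
  have "(\<Sum>B\<in>P. 2 * r B) - real (card P) = (\<Sum>B\<in>P. 2 * r B - 1)"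
    by (simp add: sum_subtractf)
  \<comment> \<open>The star \<open>B1\<close> is split off because its \<open>2 * M\<close> is
    consumed by the loss \<open>2 * (M + 1)\<close> in \<open>zq\<close>.\<close>
  also have "\<dots> = 2 * M - 1 + (\<Sum>B\<in>P - {B1}. 2 * r B - 1)"
    using finP B1 by (simp add: sum.remove M_def)
  finally have "(\<Sum>B\<in>P. 2 * r B) = real (card P) + 2 * M - 1 + (\<Sum>B\<in>P - {B1}. 2 * r B - 1)" by simp
  moreover define a where "a = (W\<^sup>2 - 2 * edge_form n E z) / W"
  ultimately show ?thesis using bound zq unfolding ysum r_def[symmetric] a_def[symmetric] by argo
qed

text \<open>A star with at most two vertices has only centres, so a non-centre leaves a block of at
  least two vertices behind.\<close>

lemma star_remove_noncentre:
  assumes "star_centre B c" "u \<in> B" "\<not> star_centre B u" "finite B"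
  shows "u \<noteq> c" "star_centre (B - {u}) c" "card B \<ge> 3"
proof -
  show uc: "u \<noteq> c" using assms by auto
  then show "star_centre (B - {u}) c" using assms by (auto simp: star_centre_def)
  obtain x where x: "x \<in> B" "x \<noteq> u" "\<not> E u x"
    using assms(2,3) by (auto simp: star_centre_def)
  have cB: "c \<in> B" using assms(1) by (simp add: star_centre_def)
  have "E u c" using assms(1,2) uc edge_sym by (auto simp: star_centre_def)
  then have "x \<noteq> c" using x by auto
  then have "card {u, c, x} = 3" using uc x by auto
  moreover have "{u, c, x} \<subseteq> B" using assms(2) x cB by auto
  ultimately show "card B \<ge> 3" using card_mono[OF assms(4)] by metis
qed

section \<open>Exchange argument for balanced star partitions\<close>

text \<open>A partition of minimal cost resists three local moves: a singleton joins the star of a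
  neighbour or pairs up with it; a leaf \<open>l\<close> and a non-centre \<open>v\<close> split off
  as a new star; \<open>l\<close> moves to the star centred at \<open>v\<close>. Their failure
  gives, in turn, the three conclusions. The condition \<open>card B \<ge> 3\<close> keeps
  \<open>B - {l}\<close> from becoming an expensive singleton.\<close>

lemma ex_balanced_star_partition:
  assumes n2: "n \<ge> 2"
  obtains P where "star_partition P" "\<And>B. B \<in> P \<Longrightarrow> card B \<ge> 2"
    "\<And>B C c l v. B \<in> P \<Longrightarrow> C \<in> P \<Longrightarrow> B \<noteq> C \<Longrightarrow> star_centre B c \<Longrightarrow> l \<in> B \<Longrightarrow> l \<noteq> c \<Longrightarrow>
      card B \<ge> 3 \<Longrightarrow> v \<in> C \<Longrightarrow> E l v \<Longrightarrow> star_centre C v \<and> card B \<le> card C + 1"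
proof -
  \<comment> \<open>Squares favour balanced partitions; the value at 1 exceeds what absorbing a singleton can cost.\<close>
  define \<phi> where "\<phi> t = (if t = 1 then 2 * n + 2 else t * t)" for t :: nat
  define cost where "cost P = (\<Sum>B\<in>P. \<phi> (card B))" for P :: "nat set set"
  have "star_partition ((\<lambda>v. {v}) ` {..<n})"
    by (auto simp: star_partition_def star_centre_def partition_on_def disjoint_def)
  then obtain P where P: "star_partition P" and min: "\<And>P'. star_partition P' \<Longrightarrow> cost P \<le> cost P'"
    using ex_has_least_nat[of star_partition _ cost] by blast
  have part: "partition_on {..<n} P" and star: "\<And>B. B \<in> P \<Longrightarrow> \<exists>c. star_centre B c"
    using P by (auto simp: star_partition_def)
  have finP: "finite P" using part by (rule finite_elements[rotated]) simp
  have sub: "B \<subseteq> {..<n}" if "B \<in> P" for B using part that by (auto simp: partition_on_def)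
  have finB: "finite B" if "B \<in> P" for B using sub[OF that] finite_subset by blast
  have disj: "B \<inter> C = {}" if "B \<in> P" "C \<in> P" "B \<noteq> C" for B C
    using part that by (auto simp: partition_on_def disjoint_def)
  have ne: "B \<noteq> {}" if "B \<in> P" for B using part that by (auto simp: partition_on_def)
  \<comment> \<open>The cost is a sum over blocks, so minimality can be tested on the two blocks
    that a move changes.\<close>
  have exchange: "\<phi> (card B) + \<phi> (card C) \<le> (\<Sum>X\<in>N. \<phi> (card X))"
    if BC: "B \<in> P" "C \<in> P" "B \<noteq> C" and N: "partition_on (B \<union> C) N" "\<And>X. X \<in> N \<Longrightarrow> \<exists>c. star_centre X c"
    for B C N
  proof -
    let ?R = "P - {B, C}"
    have UP: "\<Union>P = {..<n}" using part by (simp add: partition_on_def)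
    have UN: "\<Union>N = B \<union> C" "{} \<notin> N" "disjoint N" using N(1) by (auto simp: partition_on_def)
    have finN: "finite N" using N(1) finB BC by (intro finite_elements[OF _ N(1)]) auto
    have RN: "X \<inter> Y = {}" if "X \<in> ?R" "Y \<in> N" for X Y
    proof -
      have "Y \<subseteq> B \<union> C" using that UN by auto
      moreover have "X \<inter> B = {}" "X \<inter> C = {}" using that disj BC by auto
      ultimately show ?thesis by blast
    qed
    have disjR: "?R \<inter> N = {}" using RN UN(2) by fastforce
    have "partition_on {..<n} (?R \<union> N)"
      unfolding partition_on_def
    proof (intro conjI)
      have "\<Union>?R \<union> (B \<union> C) = \<Union>P" using BC by auto
      then show "\<Union>(?R \<union> N) = {..<n}" using UP UN(1) by auto
      show "disjoint (?R \<union> N)"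
      proof (rule disjointI)
        fix X Y assume "X \<in> ?R \<union> N" "Y \<in> ?R \<union> N" "X \<noteq> Y"
        then show "X \<inter> Y = {}"
          using RN[of X Y] RN[of Y X] disj[of X Y] disjointD[OF UN(3), of X Y] by blast
      qed
      show "{} \<notin> ?R \<union> N" using UN(2) ne by auto
    qed
    then have "star_partition (?R \<union> N)" using star N(2) by (auto simp: star_partition_def)
    then have "cost P \<le> cost (?R \<union> N)" by (rule min)
    moreover have "cost (?R \<union> N) = cost ?R + (\<Sum>X\<in>N. \<phi> (card X))"
      unfolding cost_def using finP finN disjR by (intro sum.union_disjoint) auto
    moreover have "cost P = \<phi> (card B) + (\<phi> (card C) + cost ?R)"
    proof -
      have "cost P = \<phi> (card B) + cost (P - {B})"
        unfolding cost_def using finP BC by (simp add: sum.remove)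
      also have "cost (P - {B}) = \<phi> (card C) + cost (P - {B} - {C})"
        unfolding cost_def using finP BC by (intro sum.remove) auto
      also have "P - {B} - {C} = ?R" by auto
      finally show ?thesis .
    qed
    ultimately show ?thesis by simp
  qed
  have two: "partition_on (X \<union> Y) {X, Y}" if "X \<inter> Y = {}" "X \<noteq> {}" "Y \<noteq> {}" for X Y :: "nat set"
    using that by (auto simp: partition_on_def disjoint_def)
  have block: "\<exists>C\<in>P. v \<in> C" if "v < n" for v
    using part that by (auto simp: partition_on_def)
  have big: "card B \<ge> 2" if B: "B \<in> P" for B
  proof (rule ccontr)
    assume "\<not> card B \<ge> 2"
    moreover have "card B \<noteq> 0" using ne[OF B] finB[OF B] by simp
    ultimately have "card B = 1" by linarith
    then obtain v where v: "B = {v}" using card_1_singletonE by blast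
    then have "v < n" using sub[OF B] by auto
    then obtain u where u: "E v u" using ex_neighbour[OF n2] by blast
    then obtain C where C: "C \<in> P" "u \<in> C" using block edge_less by blast
    have "u \<noteq> v" using u by auto
    then have BC: "B \<noteq> C" using C v by auto
    then have vC: "v \<notin> C" using disj[OF B C(1)] v by auto
    have cC: "card C < n"
    proof -
      have "card (insert v C) \<le> card {..<n}" using sub[OF C(1)] \<open>v < n\<close> by (intro card_mono) auto
      then show ?thesis using vC finB[OF C(1)] by simp
    qed
    have c0: "card C \<noteq> 0" using C finB[OF C(1)] by auto
    show False
    proof (cases "star_centre C u")
      case True
      have "\<phi> (card B) + \<phi> (card C) \<le> (\<Sum>X\<in>{insert v C}. \<phi> (card X))"
      proof (rule exchange[OF B C(1) BC])
        show "partition_on (B \<union> C) {insert v C}" by (auto simp: v partition_on_def disjoint_def)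
        have "star_centre (insert v C) u" using True edge_sym[OF u] by (auto simp: star_centre_def)
        then show "\<exists>c. star_centre X c" if "X \<in> {insert v C}" for X using that by blast
      qed
      then have "\<phi> 1 + \<phi> (card C) \<le> \<phi> (Suc (card C))" using vC finB[OF C(1)] v by simp
      then show False using cC c0 by (auto simp: \<phi>_def split: if_splits)
    next
      case False
      obtain c where c: "star_centre C c" using star[OF C(1)] by blast
      note rem = star_remove_noncentre[OF c C(2) False finB[OF C(1)]]
      have cin: "c \<in> C - {u}" using rem(1) c by (auto simp: star_centre_def)
      have "\<phi> (card B) + \<phi> (card C) \<le> (\<Sum>X\<in>{C - {u}, {u, v}}. \<phi> (card X))"
      proof (rule exchange[OF B C(1) BC])
        have "B \<union> C = (C - {u}) \<union> {u, v}" using v C by auto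
        then show "partition_on (B \<union> C) {C - {u}, {u, v}}"
          using two[of "C - {u}" "{u, v}"] vC cin by auto
        have "star_centre {u, v} u" using edge_sym[OF u] by (auto simp: star_centre_def)
        then show "\<exists>c. star_centre X c" if "X \<in> {C - {u}, {u, v}}" for X using that rem(2) by blast
      qed
      moreover have "C - {u} \<noteq> {u, v}" by auto
      ultimately have "\<phi> 1 + \<phi> (card C) \<le> \<phi> (card C - 1) + \<phi> 2"
        using finB[OF C(1)] C v \<open>u \<noteq> v\<close> by (simp add: numeral_2_eq_2)
      moreover obtain b where "card C = Suc (Suc (Suc b))"
        using rem(3) by (auto simp: le_iff_add numeral_3_eq_3)
      ultimately show False by (simp add: \<phi>_def)
    qed
  qed
  have "star_centre C v \<and> card B \<le> card C + 1"
    if BC: "B \<in> P" "C \<in> P" "B \<noteq> C" and c: "star_centre B c" and l: "l \<in> B" "l \<noteq> c"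
      and B3: "card B \<ge> 3" and v: "v \<in> C" "E l v" for B C c l v
  proof -
    have lC: "l \<notin> C" "v \<notin> B" using disj[OF BC] l v by auto
    have cin: "c \<in> B - {l}" using c l by (auto simp: star_centre_def)
    have cB: "star_centre (B - {l}) c" using c l by (auto simp: star_centre_def)
    have "l \<noteq> v" using v by auto
    obtain b where b: "card B = Suc (Suc (Suc b))"
      using B3 by (auto simp: le_iff_add numeral_3_eq_3)
    have cC: "star_centre C v"
    proof (rule ccontr)
      assume no: "\<not> star_centre C v"
      obtain c' where c': "star_centre C c'" using star[OF BC(2)] by blast
      note rem = star_remove_noncentre[OF c' v(1) no finB[OF BC(2)]]
      have cin': "c' \<in> C - {v}" using rem(1) c' by (auto simp: star_centre_def)
      let ?N = "{B - {l}, C - {v}, {l, v}}"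
      \<comment> \<open>For sizes \<open>b, c \<ge> 3\<close> the two old blocks save
        \<open>2 * b + 2 * c - 2\<close>, while the new edge costs only 4.\<close>
      have "\<phi> (card B) + \<phi> (card C) \<le> (\<Sum>X\<in>?N. \<phi> (card X))"
      proof (rule exchange[OF BC])
        show "partition_on (B \<union> C) ?N"
          using disj[OF BC] lC cin cin' l v unfolding partition_on_def disjoint_def by auto
        have "star_centre {l, v} l" using v by (auto simp: star_centre_def)
        then show "\<exists>c. star_centre X c" if "X \<in> ?N" for X using that rem(2) cB by blast
      qed
      also have "\<dots> = \<phi> (card B - 1) + (\<phi> (card C - 1) + \<phi> 2)"
      proof -
        have "B - {l} \<noteq> C - {v}" "B - {l} \<noteq> {l, v}" "C - {v} \<noteq> {l, v}"
          using cin cin' disj[OF BC] lC by auto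
        then show ?thesis using finB BC l v \<open>l \<noteq> v\<close> by (simp add: numeral_2_eq_2)
      qed
      finally have "\<phi> (card B) + \<phi> (card C) \<le> \<phi> (card B - 1) + (\<phi> (card C - 1) + \<phi> 2)" .
      moreover obtain b' where "card C = Suc (Suc (Suc b'))"
        using rem(3) by (auto simp: le_iff_add numeral_3_eq_3)
      ultimately show False using b by (simp add: \<phi>_def)
    qed
    \<comment> \<open>For sizes \<open>b\<close> and \<open>c\<close> this reads \<open>b\<^sup>2 +
      c\<^sup>2 \<le> (b - 1)\<^sup>2 + (c + 1)\<^sup>2\<close>, which is
      \<open>b \<le> c + 1\<close>.\<close>
    have "\<phi> (card B) + \<phi> (card C) \<le> (\<Sum>X\<in>{B - {l}, insert l C}. \<phi> (card X))"
    proof (rule exchange[OF BC])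
      have "B \<union> C = (B - {l}) \<union> insert l C" using l by auto
      then show "partition_on (B \<union> C) {B - {l}, insert l C}"
        using two[of "B - {l}" "insert l C"] disj[OF BC] cin by auto
      have "star_centre (insert l C) v" using cC edge_sym[OF v(2)] by (auto simp: star_centre_def)
      then show "\<exists>c. star_centre X c" if "X \<in> {B - {l}, insert l C}" for X using that cB by blast
    qed
    moreover have "B - {l} \<noteq> insert l C" by auto
    ultimately have "\<phi> (card B) + \<phi> (card C) \<le> \<phi> (card B - 1) + \<phi> (Suc (card C))"
      using finB BC l lC by simp
    moreover obtain b' where "card C = Suc (Suc b')"
      using big[OF BC(2)] by (auto simp: le_iff_add numeral_2_eq_2)
    ultimately have "card B \<le> card C + 1" using b by (simp add: \<phi>_def)
    with cC show ?thesis by blast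
  qed
  then show thesis using that P big by blast
qed

end

section \<open>Numerical estimates for the contribution of the smaller stars\<close>

text \<open>The ratio of \<open>2 * sqrt (t - 1) - 1\<close> to \<open>t\<close> is smallest at an end of the range
  \<open>2 \<le> t \<le> K\<close>, where it is \<open>1 / 2\<close> or \<open>(2 * sqrt (K - 1) - 1) / K\<close>.\<close>

lemma sum_star_gain_ge:
  fixes t :: "'a \<Rightarrow> nat"
  assumes fin: "finite Q" and t2: "\<And>B. B \<in> Q \<Longrightarrow> t B \<ge> 2" and K: "(\<Sum>B\<in>Q. t B) = K" "K > 0"
  shows "(\<Sum>B\<in>Q. 2 * sqrt (real (t B - 1)) - 1) \<ge> min (real K / 2) (2 * sqrt (real K - 1) - 1)"
proof -
  define h where "h = min (real K / 2) (2 * sqrt (real K - 1) - 1)"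
  have K0: "real K > 0" using K by simp
  have h: "h \<le> real K / 2" "h \<le> 2 * sqrt (real K - 1) - 1" unfolding h_def by (rule min.cobounded1 min.cobounded2)+
  have point: "real (t B) * (h / real K) \<le> 2 * sqrt (real (t B - 1)) - 1" if B: "B \<in> Q" for B
  proof -
    have tK: "t B \<le> K" using K(1) member_le_sum[OF B _ fin, of t] by simp
    define u where "u = sqrt (real (t B - 1))"
    define U where "U = sqrt (real K - 1)"
    have t: "real (t B) = u\<^sup>2 + 1" using t2[OF B] by (simp add: u_def of_nat_diff)
    have KU: "real K = U\<^sup>2 + 1" using tK t2[OF B] by (simp add: U_def)
    have u1: "u \<ge> 1" using t2[OF B] by (simp add: u_def)
    have uU: "u \<le> U" unfolding u_def U_def using tK t2[OF B] by (simp add: of_nat_diff)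
    have "(u\<^sup>2 + 1) * h \<le> (2 * u - 1) * real K"
    \<comment> \<open>\<open>2 * u - 1 \<ge> (u\<^sup>2 + 1) / 2\<close> holds exactly for
      \<open>1 \<le> u \<le> 3\<close>; beyond 3 the comparison is with the other end
      \<open>U\<close>.\<close>
    proof (cases "u \<le> 3")
      case True
      have "(u - 1) * (3 - u) \<ge> 0" using True u1 by simp
      then have le: "(u\<^sup>2 + 1) / 2 \<le> 2 * u - 1" by (simp add: power2_eq_square field_simps)
      have "(u\<^sup>2 + 1) * h \<le> (u\<^sup>2 + 1) * (real K / 2)"
        by (intro mult_left_mono) (use h in auto)
      also have "\<dots> = (u\<^sup>2 + 1) / 2 * real K" by simp
      also have "\<dots> \<le> (2 * u - 1) * real K"
        using le K0 by (intro mult_right_mono) auto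
      finally show ?thesis .
    next
      case False
      \<comment> \<open>This is \<open>(2 * u - 1) * (U\<^sup>2 + 1) - (u\<^sup>2 + 1) * (2 * U -
        1)\<close> in factored form.\<close>
      have "0 \<le> (U - u) * (u * (U - 1) + U * (u - 1) - 2)"
      proof (intro mult_nonneg_nonneg)
        have "1 * 2 \<le> u * (U - 1)" using False uU by (intro mult_mono) auto
        moreover have "0 \<le> U * (u - 1)" using False uU by simp
        ultimately show "0 \<le> u * (U - 1) + U * (u - 1) - 2" by simp
      qed (use uU in simp)
      then have "(u\<^sup>2 + 1) * (2 * U - 1) \<le> (2 * u - 1) * (U\<^sup>2 + 1)"
        by (simp add: power2_eq_square algebra_simps)
      moreover have "(u\<^sup>2 + 1) * h \<le> (u\<^sup>2 + 1) * (2 * U - 1)"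
        by (intro mult_left_mono) (use h in \<open>auto simp: U_def\<close>)
      ultimately show ?thesis unfolding KU by simp
    qed
    then show ?thesis unfolding t u_def[symmetric] using K0 by (simp add: divide_le_eq mult.commute)
  qed
  have "h = (\<Sum>B\<in>Q. real (t B) * (h / real K))"
    unfolding sum_distrib_right[symmetric] of_nat_sum[symmetric] K(1) using K0 by simp
  also have "\<dots> \<le> (\<Sum>B\<in>Q. 2 * sqrt (real (t B - 1)) - 1)"
    by (intro sum_mono point)
  finally show ?thesis by (simp add: h_def)
qed

text \<open>Here \<open>K\<close> counts the vertices outside the largest star and \<open>k\<close>
  is \<open>n - D\<close>. The bound 7 comes from the first entry of the minimum: it needs
  \<open>3 * K + 2 \<le> (K - 2)\<^sup>2\<close>, which fails at 6.\<close>

lemma min_gain_ge: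
  fixes K k :: real
  assumes K: "K \<ge> 7" and k: "2 * k \<le> 3 * K + 2" "k \<ge> 0"
  shows "1 + sqrt (k / 2) \<le> min (K / 2) (2 * sqrt (K - 1) - 1)"
proof (rule min.boundedI)
  have "0 \<le> K * (K - 7)" using K by simp
  then have "k / 2 \<le> (K / 2 - 1)\<^sup>2" using k by (simp add: power2_eq_square field_simps)
  then have "sqrt (k / 2) \<le> K / 2 - 1" using K by (intro real_le_lsqrt) auto
  then show "1 + sqrt (k / 2) \<le> K / 2" by simp
next
  define U where "U = sqrt (K - 1)"
  have U2: "U\<^sup>2 = K - 1" using K by (simp add: U_def)
  \<comment> \<open>\<open>12 / 5\<close> is a rational lower bound for \<open>sqrt 6\<close>, large
    enough for the quadratic inequality below.\<close>
  have U: "U \<ge> 12 / 5" unfolding U_def using K by (intro real_le_rsqrt) (simp add: power2_eq_square)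
  have "k / 2 \<le> (2 * U - 2)\<^sup>2"
  proof -
    have "0 \<le> (U - 12 / 5) * (13 * U - 4 / 5)" using U by (intro mult_nonneg_nonneg) auto
    then have "32 * U \<le> 13 * U\<^sup>2 + 11" by (simp add: power2_eq_square algebra_simps)
    moreover have "4 * (k / 2) \<le> 3 * U\<^sup>2 + 5" using k U2 by simp
    ultimately show ?thesis by (simp add: power2_eq_square algebra_simps)
  qed
  then have "sqrt (k / 2) \<le> 2 * U - 2" using U by (intro real_le_lsqrt) auto
  then show "1 + sqrt (k / 2) \<le> 2 * sqrt (K - 1) - 1" by (simp add: U_def)
qed


section \<open>Combination of the two energy bounds\<close>

theorem theorem1:
  fixes n :: nat and E :: "nat \<Rightarrow> nat \<Rightarrow> bool"
  assumes "is_tree n E"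
  shows "energy (seidel_matrix n E)
           \<ge> 2 * real n - 6 + sqrt (2 * (real n - real (max_leaf_nbrs n E)))"
proof -
  interpret finite_tree n E using assms by unfold_locales
  define D where "D = max_leaf_nbrs n E"
  show ?thesis
  proof (cases "n \<le> D + 8")
    case True
    then have "sqrt (2 * (real n - real D)) \<le> 4"
      by (intro real_le_lsqrt) (simp_all flip: of_nat_add)
    then show ?thesis using energy_ge unfolding D_def[symmetric] by argo
  next
    case False
    then have nD: "n \<ge> D + 9" and n2: "n \<ge> 2" by auto
    have D1: "D \<ge> 1" unfolding D_def by (rule max_leaf_nbrs_pos[OF n2])
    obtain P where P: "star_partition P" and big: "\<And>B. B \<in> P \<Longrightarrow> card B \<ge> 2"
      and balanced: "\<And>B C c l v. B \<in> P \<Longrightarrow> C \<in> P \<Longrightarrow> B \<noteq> C \<Longrightarrow> star_centre B c \<Longrightarrow> l \<in> B \<Longrightarrow>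
        l \<noteq> c \<Longrightarrow> card B \<ge> 3 \<Longrightarrow> v \<in> C \<Longrightarrow> E l v \<Longrightarrow> star_centre C v \<and> card B \<le> card C + 1"
      using ex_balanced_star_partition[OF n2] by blast
    have part: "partition_on {..<n} P" using P by (simp add: star_partition_def)
    have finP: "finite P" using part by (rule finite_elements[rotated]) simp
    have UP: "\<Union>P = {..<n}" using part by (simp add: partition_on_def)
    have finB: "finite B" if "B \<in> P" for B using UP that by (metis Union_upper finite_lessThan finite_subset)
    have disj: "B = C" if "B \<in> P" "C \<in> P" "v \<in> B" "v \<in> C" for B C v
      using part that by (auto simp: partition_on_def disjoint_def)
    have "0 \<in> \<Union>P" using UP n2 by simp
    then have "P \<noteq> {}" by auto
    then have "Max (card ` P) \<in> card ` P" using finP by (intro Max_in) auto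
    then obtain B1 where B1: "B1 \<in> P" and "card B1 = Max (card ` P)" by auto
    then have max: "card B \<le> card B1" if "B \<in> P" for B using finP that by simp
    define Q where "Q = P - {B1}"
    define d where "d = card B1 - 1"
    define K where "K = (\<Sum>B\<in>Q. card B)"
    define G where "G = (\<Sum>B\<in>Q. 2 * sqrt (real (card B - 1)) - 1)"
    have cardB1: "card B1 = Suc d" using big[OF B1] by (simp add: d_def)
    have finQ: "finite Q" using finP by (simp add: Q_def)
    have nK: "n = Suc (K + d)"
    proof -
      have "card (\<Union>P) = (\<Sum>B\<in>P. card B)"
        by (rule card_Union_disjoint) (use part finB in \<open>auto simp: partition_on_def disjoint_def pairwise_def disjnt_def\<close>)
      also have "\<dots> = card B1 + K" unfolding K_def Q_def using finP B1 by (simp add: sum.remove)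
      finally show ?thesis using UP cardB1 by simp
    qed
    have energy: "energy (seidel_matrix n E) \<ge> 2 * real n - 8 + 2 * G"
      unfolding G_def Q_def by (rule energy_ge_star_partition[OF P big B1 max])
    have G_min: "G \<ge> min (real K / 2) (2 * sqrt (real K - 1) - 1)" if "K > 0"
      unfolding G_def by (rule sum_star_gain_ge[OF finQ _ K_def[symmetric] that]) (use big in \<open>auto simp: Q_def\<close>)
    define k where "k = n - D"
    \<comment> \<open>The target is half of what \<open>2 * n - 8 + 2 * G\<close> still lacks, since
      \<open>sqrt (2 * k) = 2 * sqrt (k / 2)\<close>.\<close>
    have G_large: "1 + sqrt (real k / 2) \<le> G" if "K \<ge> 7" "2 * k \<le> 3 * K + 2"
    proof -
      have "2 * real k \<le> 3 * real K + 2" using that(2) by (simp flip: of_nat_mult of_nat_add)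
      then have "1 + sqrt (real k / 2) \<le> min (real K / 2) (2 * sqrt (real K - 1) - 1)"
        using that(1) by (intro min_gain_ge) auto
      also have "\<dots> \<le> G" using that(1) by (intro G_min) simp
      finally show ?thesis .
    qed
    have "1 + sqrt (real k / 2) \<le> G"
    proof (cases "d \<le> D")
      case True
      then show ?thesis using nK nD by (intro G_large) (auto simp: k_def)
    next
      case False
      obtain c where c: "star_centre B1 c" using P B1 by (auto simp: star_partition_def)
      have cB1: "c \<in> B1" using c by (simp add: star_centre_def)
      define L where "L = {l \<in> B1 - {c}. \<not> is_leaf n E l}"
      define e where "e = card L"
      have finL: "finite L" using finB[OF B1] by (simp add: L_def)
      \<comment> \<open>Leaves of the star outside \<open>L\<close> are leaves of the tree adjacent
        to \<open>c\<close>, so there are at most \<open>D\<close> of them.\<close>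
      have leaves: "d \<le> D + e"
      proof -
        let ?F = "{u. u < n \<and> E c u \<and> is_leaf n E u}"
        have "B1 - {c} \<subseteq> ?F \<union> L"
          using c by (auto simp: L_def star_centre_def dest: edge_less)
        then have "card (B1 - {c}) \<le> card (?F \<union> L)" using finL by (intro card_mono) auto
        also have "\<dots> \<le> card ?F + card L" by (rule card_Un_le)
        also have "card ?F \<le> D"
          unfolding D_def using cB1 B1 UP by (intro max_leaf_nbrs_ge) auto
        finally show ?thesis using cardB1 cB1 finB[OF B1] by (simp add: e_def)
      qed
      have "\<exists>C v. C \<in> Q \<and> v \<in> C \<and> E l v \<and> v \<noteq> c \<and> star_centre C v \<and> d \<le> card C" if l: "l \<in> L" for l
      proof -
        have lB: "l \<in> B1" "l \<noteq> c" "E l c" using l c edge_sym by (auto simp: L_def star_centre_def)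
        obtain v where v: "E l v" "v \<noteq> c" using is_leafI[OF lB(3)] l by (auto simp: L_def)
        have "v \<in> \<Union>P" using UP edge_less(2)[OF v(1)] by simp
        then obtain C where C: "C \<in> P" "v \<in> C" by blast
        have "v \<notin> B1" using star_edge_iff[OF c lB(1), of v] v lB by auto
        then have "B1 \<noteq> C" using C by auto
        moreover have "card B1 \<ge> 3" using False D1 cardB1 by simp
        ultimately have "star_centre C v \<and> card B1 \<le> card C + 1"
          using balanced[OF B1 C(1) _ c lB(1,2) _ C(2) v(1)] by blast
        then show ?thesis using C v \<open>B1 \<noteq> C\<close> cardB1 by (auto simp: Q_def)
      qed
      then have "\<forall>l\<in>L. \<exists>C v. C \<in> Q \<and> v \<in> C \<and> E l v \<and> v \<noteq> c \<and> star_centre C v \<and> d \<le> card C" by blast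
      from bchoice[OF this] obtain f where
        "\<forall>l\<in>L. \<exists>v. f l \<in> Q \<and> v \<in> f l \<and> E l v \<and> v \<noteq> c \<and> star_centre (f l) v \<and> d \<le> card (f l)" ..
      from bchoice[OF this] obtain v where
        "\<forall>l\<in>L. f l \<in> Q \<and> v l \<in> f l \<and> E l (v l) \<and> v l \<noteq> c \<and> star_centre (f l) (v l) \<and> d \<le> card (f l)" ..
      then have f: "f l \<in> Q" "v l \<in> f l" "E l (v l)" "v l \<noteq> c" "star_centre (f l) (v l)" "d \<le> card (f l)"
        if "l \<in> L" for l
        using that by auto
      \<comment> \<open>Two vertices of \<open>L\<close> attached to the same star would close a
        cycle through \<open>c\<close>: a square if they meet at one vertex, otherwise a
        pentagon.\<close>
      have inj: "inj_on f L"
      proof (rule inj_onI, rule ccontr)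
        fix l m assume l: "l \<in> L" and m: "m \<in> L" and eq: "f l = f m" and ne: "l \<noteq> m"
        have El: "E c l" "E m c" "l \<in> B1" "m \<in> B1"
          using l m c edge_sym by (auto simp: L_def star_centre_def)
        have out: "x \<notin> B1" if "x \<in> f l" for x
          using f(1)[OF l] that disj[OF B1, of "f l" x] by (auto simp: Q_def)
        have vl: "v l \<in> f l" "v m \<in> f l" using f(2)[OF l] f(2)[OF m] eq by auto
        show False
        proof (cases "v l = v m")
          case True
          then show False
            using no_square[of c l "v l" m] El f(3)[OF l] f(3)[OF m] f(4)[OF l] ne edge_sym by metis
        next
          case False
          then have "E (v l) (v m)" using f(5)[OF l] vl by (auto simp: star_centre_def)
          moreover have "distinct [c, l, v l, v m, m]"
            using False El out[OF vl(1)] out[OF vl(2)] cB1 ne by auto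
          ultimately show False
            using no_pentagon[of c l "v l" "v m" m] El f(3)[OF l] edge_sym[OF f(3)[OF m]] by blast
        qed
      qed
      have im: "f ` L \<subseteq> Q" and cim: "card (f ` L) = e" using f(1) inj by (auto simp: card_image e_def)
      have eK: "e * d \<le> K"
      proof -
        have "e * d \<le> (\<Sum>B\<in>f ` L. card B)"
          using sum_bounded_below[of "f ` L" d card] f(6) cim by auto
        also have "\<dots> \<le> K" unfolding K_def using im finQ by (intro sum_mono2) auto
        finally show ?thesis .
      qed
      have "2 * e \<le> e * d" using False D1 by (simp add: mult.commute)
      then have eK2: "2 * e \<le> K" using eK by (rule order_trans)
      show ?thesis
      proof (cases "K \<ge> 7")
        case True
        \<comment> \<open>\<open>k \<le> K + 1 + e\<close> and \<open>2 * e \<le> K\<close> combine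
          to \<open>2 * k \<le> 3 * K + 2\<close>.\<close>
        then show ?thesis using nK nD leaves eK2 by (intro G_large) (auto simp: k_def)
      next
        case K6: False
        \<comment> \<open>\<open>K \<le> 6\<close> and \<open>n \<ge> D + 9\<close> force
          \<open>d \<ge> D + 2\<close>, hence both bounds; \<open>e * d \<le> K\<close> then leaves
          only \<open>e = 2\<close>.\<close>
        have de: "d \<ge> 3" "e \<ge> 2" using K6 nK nD leaves D1 by auto
        have "e \<le> 2"
        proof (rule ccontr)
          assume "\<not> e \<le> 2"
          then have "3 * 3 \<le> e * d" using de by (intro mult_le_mono) auto
          then show False using eK K6 by simp
        qed
        then have e2: "e = 2" using de by simp
        then have k9: "k \<le> 9" using nK leaves K6 by (simp add: k_def)
        have s2: "sqrt 2 \<ge> 7 / 5" by (intro real_le_rsqrt) (simp add: power2_eq_square)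
        \<comment> \<open>The two stars attached to \<open>L\<close> have at least two leaves each,
          and \<open>2 * sqrt 2 - 1 \<ge> 9 / 5\<close>.\<close>
        have gain: "9 / 5 \<le> 2 * sqrt (real (card B - 1)) - 1" if "B \<in> f ` L" for B
        proof -
          have "card B \<ge> 3" using that f(6) de by fastforce
          then have "sqrt 2 \<le> sqrt (real (card B - 1))" by simp
          then show ?thesis using s2 by argo
        qed
        have "18 / 5 = (\<Sum>B\<in>f ` L. 9 / 5 :: real)" using cim e2 by simp
        also have "\<dots> \<le> (\<Sum>B\<in>f ` L. 2 * sqrt (real (card B - 1)) - 1)" by (intro sum_mono gain)
        also have "\<dots> \<le> G" unfolding G_def
        proof (intro sum_mono2 finQ im)
          fix B assume "B \<in> Q - f ` L"
          then have "card B - 1 \<ge> 1" using big[of B] by (auto simp: Q_def)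
          then have "sqrt (real (card B - 1)) \<ge> 1" by simp
          then show "0 \<le> 2 * sqrt (real (card B - 1)) - 1" by argo
        qed
        finally have "18 / 5 \<le> G" .
        \<comment> \<open>A generous bound for \<open>sqrt (9 / 2)\<close>, chosen so that
          \<open>1 + 13 / 5\<close> matches the gain \<open>18 / 5\<close>.\<close>
        moreover have "sqrt (real k / 2) \<le> 13 / 5"
          using k9 by (intro real_le_lsqrt) (simp_all add: power2_eq_square)
        ultimately show ?thesis by argo
      qed
    qed
    moreover have "sqrt (2 * (real n - real D)) = 2 * sqrt (real k / 2)"
    proof -
      have "real n - real D = real k" using nD by (simp add: k_def of_nat_diff)
      then have "2 * (real n - real D) = 2\<^sup>2 * (real k / 2)" by simp
      then show ?thesis by (simp only: real_sqrt_mult real_sqrt_abs)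
    qed
    ultimately show ?thesis using energy unfolding D_def[symmetric] by argo
  qed
qed

end
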